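(* A finite dimensional quasi-Hopf algebra $H$ over a field $\mathbf k$ is (i) unimodular if and only if one (and hence all) nonzero left (right) integrals are $S$-invariant, i.e. satisfy $S(l)=l$; (ii) symmetric (i.e. admits a nondegenerate trace) if and only if it is unimodular and $S^2$ is an inner automorphism.
   Context: $\mathbf k$ is a field, algebras are unital. A quasi-bialgebra $(H,\Delta,\epsilon,\phi)$ is a unital $\mathbf k$-algebra $H$ with unital algebra morphisms $\Delta:H\to H\otimes H$, $\epsilon:H\to\mathbf k$ and an invertible $\phi\in H\otimes H\otimes H$ such that $(\mathrm{id}\otimes\Delta)(\Delta(a))\,\phi=\phi\,(\Delta\otimes\mathrm{id})(\Delta(a))$ for all $a\in H$; $(\mathrm{id}\otimes\mathrm{id}\otimes\Delta)(\phi)(\Delta\otimes\mathrm{id}\otimes\mathrm{id})(\phi)=(\mathbf 1\otimes\phi)(\mathrm{id}\otimes\Delta\otimes\mathrm{id})(\phi)(\phi\otimes\mathbf 1)$; $(\epsilon\otimes\mathrm{id})\circ\Delta=\mathrm{id}=(\mathrm{id}\otimes\epsilon)\circ\Delta$; $(\mathrm{id}\otimes\epsilon\otimes\mathrm{id})(\phi)=\mathbf 1\otimes\mathbf 1$. Write $\Delta(a)=a_{(1)}\otimes a_{(2)}$, $\phi=X^j\otimes Y^j\otimes Z^j$, $\phi^{-1}=\bar X^j\otimes\bar Y^j\otimes\bar Z^j$ (summation suppressed). $H$ is a quasi-Hopf algebra if there are an algebra anti-morphism $S:H\to H$ (the antipode) and $\alpha,\beta\in H$ with $S(a_{(1)})\alpha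 a_{(2)}=\epsilon(a)\alpha$, $a_{(1)}\beta S(a_{(2)})=\epsilon(a)\beta$ for all $a$, and $X^j\beta S(Y^j)\alpha Z^j=\mathbf 1=S(\bar X^j)\alpha\bar Y^j\beta S(\bar Z^j)$. Standing conventions: $S$ is invertible and $\epsilon(\alpha)=\epsilon(\beta)=1$. A left (right) integral is $l\in H$ with $al=\epsilon(a)l$ (resp. $la=\epsilon(a)l$) for all $a\in H$; in a finite dimensional quasi-Hopf algebra the spaces of left and of right integrals are one dimensional. The modulus is the algebra morphism $\mu:H\to\mathbf k$ with $la=\mu(a)l$ for all left integrals $l$. $H$ is unimodular if $\mu=\epsilon$, equivalently if one (and therefore all) nonzero integrals are two-sided. A nondegenerate trace is a functional $\tau$ on $H$ with $\tau(ab)=\tau(ba)$ such that $(a,b)\mapsto\tau(ab)$ is nondegenerate. *)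

theory Defs
  imports Complex_Main "HOL-Library.Function_Algebras"
begin

(* Tensor powers.  The n-th tensor power of a vector space H over 'k is modelled by the
   functionals on n-linear forms spanned by the evaluations "pure [x1, ..., xn]"; an
   n-linear form is a function on lists of which only the values at lists of length n matter.
   Over a field this is the usual tensor power: the lemmas pure_multilinear, tlift_pure,
   tlift_add, tlift_scale and tlift_unique below are its universal property.  The empty and
   singleton lists give the copies of 'k and of H. *)

type_synonym ('a, 'k) tensor = "('a list \<Rightarrow> 'k) \<Rightarrow> 'k"

definition tscale :: "'k::field \<Rightarrow> ('a, 'k) tensor \<Rightarrow> ('a, 'k) tensor" where
  "tscale c t = (\<lambda>f. c * t f)"

definition inner_automorphism :: "('a::ring_1 \<Rightarrow> 'a) \<Rightarrow> bool" where
  "inner_automorphism f \<longleftrightarrow>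
     (\<exists>g g'. g * g' = 1 \<and> g' * g = 1 \<and> (\<forall>a. f a = g * a * g'))"

locale unital_algebra = vector_space scale
  for scale :: "'k::field \<Rightarrow> 'a::ring_1 \<Rightarrow> 'a" +
  assumes scale_mult_left: "scale c x * y = scale c (x * y)"
    and scale_mult_right: "x * scale c y = scale c (x * y)"
begin

definition multilinear ::
    "('k \<Rightarrow> 'w::ab_group_add \<Rightarrow> 'w) \<Rightarrow> nat \<Rightarrow> ('a list \<Rightarrow> 'w) \<Rightarrow> bool" where
  "multilinear sW n f \<longleftrightarrow>
     (\<forall>xs i. length xs = n \<and> i < n \<longrightarrow> Vector_Spaces.linear scale sW (\<lambda>x. f (xs[i := x])))"

definition pure :: "'a list \<Rightarrow> ('a, 'k) tensor" where
  "pure xs = (\<lambda>f. if multilinear (*) (length xs) f then f xs else 0)"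

definition tensor_power :: "nat \<Rightarrow> ('a, 'k) tensor set" where
  "tensor_power n = module.span tscale {pure xs |xs. length xs = n}"

(* The linear map on the n-th tensor power induced by an n-linear map F into a vector space
   with scaling sW: write t as a sum of pure tensors and apply F to each of them. *)
definition tlift ::
    "nat \<Rightarrow> ('k \<Rightarrow> 'w::ab_group_add \<Rightarrow> 'w) \<Rightarrow> ('a list \<Rightarrow> 'w) \<Rightarrow> ('a, 'k) tensor \<Rightarrow> 'w" where
  "tlift n sW F t =
     (THE w. \<exists>A c. finite A \<and> (\<forall>xs\<in>A. length xs = n) \<and>
        t = (\<Sum>xs\<in>A. tscale (c xs) (pure xs)) \<and> w = (\<Sum>xs\<in>A. sW (c xs) (F xs)))"

abbreviation tlift2 where
  "tlift2 sW F \<equiv> tlift 2 sW (\<lambda>xs. F (xs ! 0) (xs ! 1))"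

abbreviation tlift3 where
  "tlift3 sW F \<equiv> tlift 3 sW (\<lambda>xs. F (xs ! 0) (xs ! 1) (xs ! 2))"

definition tone :: "nat \<Rightarrow> ('a, 'k) tensor" where
  "tone n = pure (replicate n 1)"

definition tmult :: "nat \<Rightarrow> ('a, 'k) tensor \<Rightarrow> ('a, 'k) tensor \<Rightarrow> ('a, 'k) tensor" where
  "tmult n s t = tlift n tscale (\<lambda>xs. tlift n tscale (\<lambda>ys. pure (map2 (*) xs ys)) t) s"

definition tinverse :: "nat \<Rightarrow> ('a, 'k) tensor \<Rightarrow> ('a, 'k) tensor" where
  "tinverse n t =
     (THE u. u \<in> tensor_power n \<and> tmult n t u = tone n \<and> tmult n u t = tone n)"

(* s \<otimes> t for s in the m-th and t in the n-th tensor power *)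
definition tcat :: "nat \<Rightarrow> nat \<Rightarrow> ('a, 'k) tensor \<Rightarrow> ('a, 'k) tensor \<Rightarrow> ('a, 'k) tensor" where
  "tcat m n s t = tlift m tscale (\<lambda>xs. tlift n tscale (\<lambda>ys. pure (xs @ ys)) t) s"

definition algebra_character :: "('a \<Rightarrow> 'k) \<Rightarrow> bool" where
  "algebra_character \<chi> \<longleftrightarrow>
     Vector_Spaces.linear scale (*) \<chi> \<and> \<chi> 1 = 1 \<and> (\<forall>a b. \<chi> (a * b) = \<chi> a * \<chi> b)"

definition nondegenerate_trace :: "('a \<Rightarrow> 'k) \<Rightarrow> bool" where
  "nondegenerate_trace \<tau> \<longleftrightarrow>
     Vector_Spaces.linear scale (*) \<tau> \<and>
     (\<forall>a b. \<tau> (a * b) = \<tau> (b * a)) \<and>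
     (\<forall>a. (\<forall>b. \<tau> (a * b) = 0) \<longrightarrow> a = 0) \<and>
     (\<forall>b. (\<forall>a. \<tau> (a * b) = 0) \<longrightarrow> b = 0)"

definition symmetric_algebra :: bool where
  "symmetric_algebra \<longleftrightarrow> (\<exists>\<tau>. nondegenerate_trace \<tau>)"

definition finite_dimensional :: bool where
  "finite_dimensional \<longleftrightarrow> (\<exists>B. finite_dimensional_vector_space scale B)"

end

lemma vector_space_tscale: "vector_space (tscale :: 'k::field \<Rightarrow> ('a, 'k) tensor \<Rightarrow> _)"
  by unfold_locales (auto simp: tscale_def fun_eq_iff algebra_simps)

lemma vector_space_times: "vector_space ((*) :: 'k::field \<Rightarrow> 'k \<Rightarrow> 'k)"
  by unfold_locales (auto simp: algebra_simps)

lemma functionals_separate: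
  fixes sW :: "'k::field \<Rightarrow> 'w::ab_group_add \<Rightarrow> 'w"
  assumes "vector_space sW" and "\<And>h. Vector_Spaces.linear sW (*) h \<Longrightarrow> h v = h w"
  shows "v = w"
proof (rule ccontr)
  assume "v \<noteq> w"
  interpret W: vector_space sW by fact
  interpret P: vector_space_pair sW "(*) :: 'k \<Rightarrow> 'k \<Rightarrow> 'k"
    by (intro vector_space_pair.intro assms(1) vector_space_times)
  have "W.independent {v - w}"
    using \<open>v \<noteq> w\<close> by (simp add: W.dependent_single)
  from P.linear_independent_extend[OF this, of "\<lambda>_. 1"]
  obtain h where h: "Vector_Spaces.linear sW (*) h" "h (v - w) = 1" by auto
  have "h (v - w) = h v - h w" by (rule P.linear_diff[OF h(1)])
  then show False using assms(2)[OF h(1)] h(2) by simp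
qed

lemma sum_fun_apply: "(\<Sum>x\<in>A. g x) f = (\<Sum>x\<in>A. g x f)"
  by (induction A rule: infinite_finite_induct) auto

context unital_algebra
begin

lemma pure_multilinear: "multilinear tscale n pure"
  unfolding multilinear_def
proof (intro allI impI)
  fix xs :: "'a list" and i assume xs: "length xs = n \<and> i < n"
  have "pure (xs[i := x + y]) = pure (xs[i := x]) + pure (xs[i := y])" for x y
  proof
    fix f :: "'a list \<Rightarrow> 'k"
    show "pure (xs[i := x + y]) f = (pure (xs[i := x]) + pure (xs[i := y])) f"
    proof (cases "multilinear (*) n f")
      case True
      then interpret Vector_Spaces.linear scale "(*)" "\<lambda>x. f (xs[i := x])"
        using xs unfolding multilinear_def by blast
      show ?thesis using True xs add by (simp add: pure_def)
    qed (use xs in \<open>simp add: pure_def\<close>)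
  qed
  moreover have "pure (xs[i := scale c x]) = tscale c (pure (xs[i := x]))" for c x
  proof
    fix f :: "'a list \<Rightarrow> 'k"
    show "pure (xs[i := scale c x]) f = tscale c (pure (xs[i := x])) f"
    proof (cases "multilinear (*) n f")
      case True
      then interpret L: Vector_Spaces.linear scale "(*)" "\<lambda>x. f (xs[i := x])"
        using xs unfolding multilinear_def by blast
      show ?thesis using True xs L.scale by (simp add: pure_def tscale_def)
    qed (use xs in \<open>simp add: pure_def tscale_def\<close>)
  qed
  ultimately show "Vector_Spaces.linear scale tscale (\<lambda>x. pure (xs[i := x]))"
    using vector_space_axioms vector_space_tscale
    by (simp add: Vector_Spaces.linear_def module_hom_def module_hom_axioms_def
        module_iff_vector_space)
qed

lemma tensor_power_explicit:
  "t \<in> tensor_power n \<longleftrightarrow> (\<exists>A c. finite A \<and> (\<forall>xs\<in>A. length xs = n) \<and>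
     t = (\<Sum>xs\<in>A. tscale (c xs) (pure xs)))" (is "_ \<longleftrightarrow> ?R")
proof -
  interpret T: vector_space "tscale :: 'k \<Rightarrow> ('a, 'k) tensor \<Rightarrow> _"
    by (rule vector_space_tscale)
  show ?thesis
  proof
    assume "t \<in> tensor_power n"
    then obtain B r where B: "finite B" "B \<subseteq> pure ` {xs. length xs = n}"
        and t: "t = (\<Sum>b\<in>B. tscale (r b) b)"
      unfolding tensor_power_def T.span_explicit image_Collect[symmetric] Setcompr_eq_image
      by blast
    then obtain A where A: "A \<subseteq> {xs. length xs = n}" "inj_on pure A" "B = pure ` A"
      unfolding subset_image_inj by blast
    then have "finite A" using B(1) finite_imageD by blast
    moreover have "t = (\<Sum>xs\<in>A. tscale (r (pure xs)) (pure xs))"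
      using t A by (simp add: sum.reindex)
    ultimately show ?R using A(1)
      by (intro exI[of _ A] exI[of _ "\<lambda>xs. r (pure xs)"]) auto
  next
    assume ?R
    then show "t \<in> tensor_power n"
      unfolding tensor_power_def by (elim exE conjE, hypsubst)
        (intro T.span_sum T.span_scale T.span_base, blast)
  qed
qed

lemma tlift_sum:
  assumes W: "vector_space sW" and F: "multilinear sW n F"
    and A: "finite A" "\<And>xs. xs \<in> A \<Longrightarrow> length xs = n"
  shows "tlift n sW F (\<Sum>xs\<in>A. tscale (c xs) (pure xs)) = (\<Sum>xs\<in>A. sW (c xs) (F xs))"
proof -
  have eval: "(\<Sum>xs\<in>B. tscale (d xs) (pure xs)) (\<lambda>xs. h (F xs)) = h (\<Sum>xs\<in>B. sW (d xs) (F xs))"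
    if h: "Vector_Spaces.linear sW (*) h" and B: "\<forall>xs\<in>B. length xs = n" for h B d
  proof -
    interpret h: Vector_Spaces.linear sW "(*)" h by fact
    have "multilinear (*) n (\<lambda>xs. h (F xs))"
      using F Vector_Spaces.linear_compose[OF _ h, unfolded o_def] unfolding multilinear_def by blast
    then show ?thesis using B
      by (simp add: sum_fun_apply tscale_def pure_def h.sum h.scale)
  qed
  show ?thesis unfolding tlift_def
  proof (rule the_equality)
    show "\<exists>B d. finite B \<and> (\<forall>xs\<in>B. length xs = n) \<and>
        (\<Sum>xs\<in>A. tscale (c xs) (pure xs)) = (\<Sum>xs\<in>B. tscale (d xs) (pure xs)) \<and>
        (\<Sum>xs\<in>A. sW (c xs) (F xs)) = (\<Sum>xs\<in>B. sW (d xs) (F xs))"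
      using A by blast
  next
    fix w
    assume "\<exists>B d. finite B \<and> (\<forall>xs\<in>B. length xs = n) \<and>
        (\<Sum>xs\<in>A. tscale (c xs) (pure xs)) = (\<Sum>xs\<in>B. tscale (d xs) (pure xs)) \<and>
        w = (\<Sum>xs\<in>B. sW (d xs) (F xs))"
    then obtain B d where B: "\<forall>xs\<in>B. length xs = n"
      "(\<Sum>xs\<in>A. tscale (c xs) (pure xs)) = (\<Sum>xs\<in>B. tscale (d xs) (pure xs))"
      "w = (\<Sum>xs\<in>B. sW (d xs) (F xs))" by blast
    show "w = (\<Sum>xs\<in>A. sW (c xs) (F xs))"
    proof (rule functionals_separate[OF W])
      fix h assume h: "Vector_Spaces.linear sW (*) h"
      show "h w = h (\<Sum>xs\<in>A. sW (c xs) (F xs))"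
        using eval[OF h, of A c] eval[OF h B(1), of d] A B by simp
    qed
  qed
qed

lemma tlift_pure:
  assumes "vector_space sW" and "multilinear sW n F" and "length xs = n"
  shows "tlift n sW F (pure xs) = F xs"
proof -
  interpret W: vector_space sW by fact
  have "tscale 1 (pure xs) = pure xs" by (simp add: tscale_def)
  then show ?thesis
    using tlift_sum[OF assms(1,2), of "{xs}" "\<lambda>_. 1"] assms(3) by simp
qed

lemma tlift_scale:
  assumes W: "vector_space sW" and F: "multilinear sW n F" and t: "t \<in> tensor_power n"
  shows "tlift n sW F (tscale a t) = sW a (tlift n sW F t)"
proof -
  interpret W: vector_space sW by fact
  interpret T: vector_space "tscale :: 'k \<Rightarrow> ('a, 'k) tensor \<Rightarrow> _"
    by (rule vector_space_tscale)
  from t obtain A c where A: "finite A" "\<forall>xs\<in>A. length xs = n"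
    and t_eq: "t = (\<Sum>xs\<in>A. tscale (c xs) (pure xs))"
    unfolding tensor_power_explicit by blast
  have "tscale a t = (\<Sum>xs\<in>A. tscale (a * c xs) (pure xs))"
    by (simp add: t_eq T.scale_sum_right)
  then show ?thesis
    using A by (simp add: t_eq tlift_sum[OF W F] W.scale_sum_right)
qed

lemma tlift_add:
  assumes W: "vector_space sW" and F: "multilinear sW n F"
    and s: "s \<in> tensor_power n" and t: "t \<in> tensor_power n"
  shows "tlift n sW F (s + t) = tlift n sW F s + tlift n sW F t"
proof -
  interpret W: vector_space sW by fact
  interpret T: vector_space "tscale :: 'k \<Rightarrow> ('a, 'k) tensor \<Rightarrow> _"
    by (rule vector_space_tscale)
  from s obtain A c where A: "finite A" "\<forall>xs\<in>A. length xs = n"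
    and s_eq: "s = (\<Sum>xs\<in>A. tscale (c xs) (pure xs))"
    unfolding tensor_power_explicit by blast
  from t obtain B d where B: "finite B" "\<forall>xs\<in>B. length xs = n"
    and t_eq: "t = (\<Sum>xs\<in>B. tscale (d xs) (pure xs))"
    unfolding tensor_power_explicit by blast
  define c' where "c' xs = (if xs \<in> A then c xs else 0)" for xs
  define d' where "d' xs = (if xs \<in> B then d xs else 0)" for xs
  have s': "s = (\<Sum>xs\<in>A \<union> B. tscale (c' xs) (pure xs))"
    unfolding s_eq using A B by (intro sum.mono_neutral_cong_left) (auto simp: c'_def)
  have t': "t = (\<Sum>xs\<in>A \<union> B. tscale (d' xs) (pure xs))"
    unfolding t_eq using A B by (intro sum.mono_neutral_cong_left) (auto simp: d'_def)
  have st: "s + t = (\<Sum>xs\<in>A \<union> B. tscale (c' xs + d' xs) (pure xs))"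
    unfolding s' t' by (simp add: sum.distrib T.scale_left_distrib)
  have AB: "finite (A \<union> B)" "\<And>xs. xs \<in> A \<union> B \<Longrightarrow> length xs = n" using A B by auto
  show ?thesis
    unfolding st by (subst s', subst t')
      (simp only: tlift_sum[OF W F AB] sum.distrib W.scale_left_distrib)
qed

lemma tlift_unique:
  assumes W: "vector_space sW" and F: "multilinear sW n F"
    and "\<And>xs. length xs = n \<Longrightarrow> L (pure xs) = F xs"
    and "\<And>s t. s \<in> tensor_power n \<Longrightarrow> t \<in> tensor_power n \<Longrightarrow> L (s + t) = L s + L t"
    and "\<And>a t. t \<in> tensor_power n \<Longrightarrow> L (tscale a t) = sW a (L t)"
    and "t \<in> tensor_power n"
  shows "L t = tlift n sW F t"
proof -
  interpret W: vector_space sW by fact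
  interpret T: vector_space "tscale :: 'k \<Rightarrow> ('a, 'k) tensor \<Rightarrow> _"
    by (rule vector_space_tscale)
  have p: "pure xs \<in> tensor_power n" if "length xs = n" for xs
    using that unfolding tensor_power_def by (auto intro: T.span_base)
  have L0: "L 0 = 0"
    using assms(5)[of 0 0] by (simp add: tensor_power_def T.span_zero)
  have "L (\<Sum>xs\<in>A. tscale (c xs) (pure xs)) = (\<Sum>xs\<in>A. sW (c xs) (F xs))"
    if "finite A" "\<forall>xs\<in>A. length xs = n" for A c
    using that
  proof (induction A rule: finite_induct)
    case (insert xs A)
    have "tscale (c xs) (pure xs) \<in> tensor_power n"
      using p insert.prems unfolding tensor_power_def by (auto intro: T.span_scale)
    moreover have "(\<Sum>xs\<in>A. tscale (c xs) (pure xs)) \<in> tensor_power n"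
      using insert unfolding tensor_power_explicit by blast
    ultimately have "L (tscale (c xs) (pure xs) + (\<Sum>xs\<in>A. tscale (c xs) (pure xs))) =
        sW (c xs) (F xs) + (\<Sum>xs\<in>A. sW (c xs) (F xs))"
      using insert.IH insert.prems p by (simp add: assms(3,4,5) del: plus_fun_apply plus_fun_def)
    then show ?case by (simp only: sum.insert[OF insert.hyps])
  qed (simp add: L0)
  then show ?thesis
    using assms(6) tlift_sum[OF W F] unfolding tensor_power_explicit by force
qed

lemma multilinear_cong:
  assumes "\<And>xs. length xs = n \<Longrightarrow> F xs = G xs"
  shows "multilinear sW n F \<longleftrightarrow> multilinear sW n G"
  using assms by (simp add: multilinear_def)

lemma linear_mult_left: "Vector_Spaces.linear scale scale (\<lambda>y. x * y)"
  and linear_mult_right: "Vector_Spaces.linear scale scale (\<lambda>x. x * y)"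
  using vector_space_axioms
  by (simp_all add: Vector_Spaces.linear_def module_hom_def module_hom_axioms_def
      module_iff_vector_space scale_mult_left scale_mult_right algebra_simps)

lemma map2_update_left:
  assumes "length xs = length ys" and "i < length xs"
  shows "map2 (*) (xs[i := x]) ys = (map2 (*) xs ys)[i := x * ys ! i]"
  using assms by (intro nth_equalityI) (auto simp: nth_list_update)

lemma map2_update_right:
  assumes "length xs = length ys" and "i < length xs"
  shows "map2 (*) xs (ys[i := y]) = (map2 (*) xs ys)[i := xs ! i * y]"
  using assms by (intro nth_equalityI) (auto simp: nth_list_update)

lemma tmult_pure:
  assumes xs: "length xs = n" and ys: "length ys = n"
  shows "tmult n (pure xs) (pure ys) = pure (map2 (*) xs ys)"
proof -
  have lin: "Vector_Spaces.linear scale tscale (\<lambda>x. pure (zs[i := x]))"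
    if "length zs = n" "i < n" for zs i
    using pure_multilinear that unfolding multilinear_def by blast
  have right: "multilinear tscale n (\<lambda>ys. pure (map2 (*) xs ys))" if "length xs = n" for xs
    unfolding multilinear_def
    using that Vector_Spaces.linear_compose[OF linear_mult_left lin, unfolded o_def]
    by (simp add: map2_update_right)
  have left: "multilinear tscale n (\<lambda>xs. pure (map2 (*) xs ys))"
    unfolding multilinear_def
    using ys Vector_Spaces.linear_compose[OF linear_mult_right lin, unfolded o_def]
    by (simp add: map2_update_left)
  have inner: "tlift n tscale (\<lambda>ys. pure (map2 (*) xs ys)) (pure ys) = pure (map2 (*) xs ys)"
    if "length xs = n" for xs
    using tlift_pure[OF vector_space_tscale right[OF that] ys] .
  have "multilinear tscale n (\<lambda>xs. tlift n tscale (\<lambda>ys. pure (map2 (*) xs ys)) (pure ys))"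
    by (subst multilinear_cong[OF inner]) (assumption, rule left)
  from tlift_pure[OF vector_space_tscale this xs] show ?thesis
    unfolding tmult_def using inner[OF xs] by simp
qed

lemma tcat_pure:
  assumes xs: "length xs = m" and ys: "length ys = n"
  shows "tcat m n (pure xs) (pure ys) = pure (xs @ ys)"
proof -
  have lin: "Vector_Spaces.linear scale tscale (\<lambda>x. pure (zs[i := x]))"
    if "i < length zs" for zs i
    using pure_multilinear that unfolding multilinear_def by blast
  have right: "multilinear tscale n (\<lambda>ys. pure (xs @ ys))" for xs
    unfolding multilinear_def
  proof (intro allI impI)
    fix ys :: "'a list" and i assume "length ys = n \<and> i < n"
    then show "Vector_Spaces.linear scale tscale (\<lambda>y. pure (xs @ ys[i := y]))"
      using lin[of "length xs + i" "xs @ ys"] by (simp add: list_update_append)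
  qed
  have left: "multilinear tscale m (\<lambda>xs. pure (xs @ ys))"
    unfolding multilinear_def
  proof (intro allI impI)
    fix xs :: "'a list" and i assume "length xs = m \<and> i < m"
    then show "Vector_Spaces.linear scale tscale (\<lambda>x. pure (xs[i := x] @ ys))"
      using lin[of i "xs @ ys"] by (simp add: list_update_append)
  qed
  have inner: "tlift n tscale (\<lambda>ys. pure (xs @ ys)) (pure ys) = pure (xs @ ys)" for xs
    using tlift_pure[OF vector_space_tscale right ys] .
  show ?thesis
    unfolding tcat_def inner by (rule tlift_pure[OF vector_space_tscale left xs])
qed

end

locale quasi_bialgebra = unital_algebra scale
  for scale :: "'k::field \<Rightarrow> 'a::ring_1 \<Rightarrow> 'a" +
  fixes \<Delta> :: "'a \<Rightarrow> ('a, 'k) tensor" and \<epsilon> :: "'a \<Rightarrow> 'k" and \<phi> :: "('a, 'k) tensor"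
  assumes comult_in: "\<Delta> a \<in> tensor_power 2"
    and comult_linear: "Vector_Spaces.linear scale tscale \<Delta>"
    and comult_one: "\<Delta> 1 = tone 2"
    and comult_mult: "\<Delta> (a * b) = tmult 2 (\<Delta> a) (\<Delta> b)"
    and counit: "algebra_character \<epsilon>"
    and assoc_in: "\<phi> \<in> tensor_power 3"
    and assoc_invertible:
      "\<exists>\<psi>\<in>tensor_power 3. tmult 3 \<phi> \<psi> = tone 3 \<and> tmult 3 \<psi> \<phi> = tone 3"
    and quasi_coassociative:
      "tmult 3 (tlift2 tscale (\<lambda>x y. tcat 1 2 (pure [x]) (\<Delta> y)) (\<Delta> a)) \<phi> =
       tmult 3 \<phi> (tlift2 tscale (\<lambda>x y. tcat 2 1 (\<Delta> x) (pure [y])) (\<Delta> a))"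
    and pentagon:
      "tmult 4
         (tlift3 tscale (\<lambda>x y z. tcat 2 2 (pure [x, y]) (\<Delta> z)) \<phi>)
         (tlift3 tscale (\<lambda>x y z. tcat 2 2 (\<Delta> x) (pure [y, z])) \<phi>) =
       tmult 4
         (tmult 4
           (tcat 1 3 (tone 1) \<phi>)
           (tlift3 tscale (\<lambda>x y z. tcat 3 1 (tcat 1 2 (pure [x]) (\<Delta> y)) (pure [z])) \<phi>))
         (tcat 3 1 \<phi> (tone 1))"
    and counit_left: "tlift2 scale (\<lambda>x y. scale (\<epsilon> x) y) (\<Delta> a) = a"
    and counit_right: "tlift2 scale (\<lambda>x y. scale (\<epsilon> y) x) (\<Delta> a) = a"
    and assoc_counit: "tlift3 tscale (\<lambda>x y z. tscale (\<epsilon> y) (pure [x, z])) \<phi> = tone 2"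
begin

definition left_integral :: "'a \<Rightarrow> bool" where
  "left_integral l \<longleftrightarrow> (\<forall>a. a * l = scale (\<epsilon> a) l)"

definition right_integral :: "'a \<Rightarrow> bool" where
  "right_integral l \<longleftrightarrow> (\<forall>a. l * a = scale (\<epsilon> a) l)"

(* Well defined for a finite dimensional quasi-Hopf algebra, where the space of left integrals
   is one dimensional. *)
definition modulus :: "'a \<Rightarrow> 'k" where
  "modulus = (THE \<mu>. algebra_character \<mu> \<and> (\<forall>l a. left_integral l \<longrightarrow> l * a = scale (\<mu> a) l))"

definition unimodular :: bool where
  "unimodular \<longleftrightarrow> modulus = \<epsilon>"

end

locale quasi_hopf_algebra = quasi_bialgebra scale \<Delta> \<epsilon> \<phi>
  for scale :: "'k::field \<Rightarrow> 'a::ring_1 \<Rightarrow> 'a" and \<Delta> \<epsilon> \<phi> +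
  fixes S :: "'a \<Rightarrow> 'a" and \<alpha> \<beta> :: 'a
  assumes antipode_linear: "Vector_Spaces.linear scale scale S"
    and antipode_one: "S 1 = 1"
    and antipode_mult: "S (a * b) = S b * S a"
    and antipode_bij: "bij S"
    and antipode_left: "tlift2 scale (\<lambda>x y. S x * \<alpha> * y) (\<Delta> a) = scale (\<epsilon> a) \<alpha>"
    and antipode_right: "tlift2 scale (\<lambda>x y. x * \<beta> * S y) (\<Delta> a) = scale (\<epsilon> a) \<beta>"
    and antipode_assoc: "tlift3 scale (\<lambda>x y z. x * \<beta> * S y * \<alpha> * z) \<phi> = 1"
    and antipode_assoc_inverse:
      "tlift3 scale (\<lambda>x y z. S x * \<alpha> * y * \<beta> * S z) (tinverse 3 \<phi>) = 1"
    and counit_alpha: "\<epsilon> \<alpha> = 1"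
    and counit_beta: "\<epsilon> \<beta> = 1"

end

theory Submission
  imports Defs
begin

text \<open>For a left integral \<open>l\<close>, with \<open>q = X \<otimes> S\<^sup>-\<^sup>1(\<alpha> Z) Y\<close> and \<open>p = x \<otimes> y \<beta> S(z)\<close>, where \<open>\<phi> = X \<otimes> Y \<otimes> Z\<close> and
  \<open>\<phi>\<^sup>-\<^sup>1 = x \<otimes> y \<otimes> z\<close>, the element \<open>e \<otimes> f = (id \<otimes> S)(q \<Delta>(l) p)\<close> is a Casimir element:
  \<open>a e \<otimes> f = e \<otimes> f a\<close>. The pentagon gives \<open>\<Delta>(q\<^sub>1) p (1 \<otimes> S(q\<^sub>2)) = 1 \<otimes> 1\<close> and
  \<open>(1 \<otimes> S\<^sup>-\<^sup>1(p\<^sub>2)) q \<Delta>(p\<^sub>1) = 1 \<otimes> 1\<close>; the first yields a nonzero left integral, as a trace over a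
  basis, and the second shows that \<open>e \<otimes> f\<close> is nondegenerate when \<open>l \<noteq> 0\<close>. So \<open>H\<close> is a Frobenius
  algebra, whence integrals are unique up to scalars. If \<open>l\<close> is two-sided, comparing \<open>e \<epsilon>(f) = l\<close>
  with \<open>\<epsilon>(e) f = S(l)\<close> gives \<open>S(l) = l\<close>, and \<open>e a \<otimes> f = e \<otimes> S\<^sup>2(a) f\<close> says that \<open>S\<^sup>2\<close> is the Nakayama
  automorphism: for a symmetrizing trace \<open>\<tau>\<close> the element \<open>t = \<tau>(e) f\<close> satisfies \<open>t a = S\<^sup>2(a) t\<close>,
  and conversely.\<close>

section \<open>Sweedler sums in coordinates\<close>

text \<open>In a Hopf algebra the maps
  \<open>a \<otimes> b \<mapsto> a\<^sub>1 \<otimes> a\<^sub>2 b\<close> and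
  \<open>a \<otimes> b \<mapsto> a\<^sub>1 \<otimes> S(a\<^sub>2) b\<close> are inverse to each
  other, and the theory of integrals rests on this. Without coassociativity the antipodes no longer
  cancel; p and q are the corrections by \<phi> that restore the cancellation. The first map becomes
  \<open>a \<otimes> b \<mapsto> \<Delta>(a) p (1 \<otimes> b)\<close>, the second uses
  \<open>(id \<otimes> S)(q \<Delta>(a))\<close>, and the two consequences of the pentagon, together
  with rules for moving elements through p and q, make them inverse. The convolution product on the
  dual of \<open>H\<close> is in general not associative either, so the usual argument with modules
  over the dual is replaced by partial traces over a basis. The comparison that yields
  \<open>S(l) = l\<close> goes through a Frobenius functional \<kappa> with
  \<open>\<kappa>(e) f = 1\<close>: a two-sided \<open>l\<close> equals both
  \<open>\<kappa>(l) l\<close> and \<open>\<kappa>(l) S(l)\<close>. Tensor identities are tested on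
  \<open>H\<close>-valued multilinear maps; a functional on one leg enters as a coefficient, as in
  \<open>g f *s e\<close>. Tensor-valued maps occur only where the axioms are translated.\<close>

named_theorems lin_intros

text \<open>\<open>K\<close> lists the pure summands of a fixed element of the third tensor power,
  later \<phi> or its inverse, and \<open>tri K\<close> is evaluation of that tensor on trilinear
  maps. Coefficients are absorbed into the entries.\<close>

definition tri :: "('a \<times> 'a \<times> 'a) list \<Rightarrow> ('a \<Rightarrow> 'a \<Rightarrow> 'a \<Rightarrow> 'b::comm_monoid_add) \<Rightarrow> 'b" where
  "tri K F = (\<Sum>(x, y, z)\<leftarrow>K. F x y z)"

lemma tri_swap:
  fixes F :: "'a \<Rightarrow> 'a \<Rightarrow> 'a \<Rightarrow> 'd \<Rightarrow> 'd \<Rightarrow> 'd \<Rightarrow> 'c::comm_monoid_add"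
  shows "tri K (\<lambda>x y z. tri M (F x y z)) = tri M (\<lambda>u v w. tri K (\<lambda>x y z. F x y z u v w))"
proof (induction K)
  case Nil
  then show ?case by (induction M) (auto simp: tri_def)
next
  case (Cons a K)
  have "tri M (\<lambda>u v w. f u v w + g u v w) = tri M f + tri M g"
    for f g :: "'d \<Rightarrow> 'd \<Rightarrow> 'd \<Rightarrow> 'c"
    by (induction M) (auto simp: tri_def algebra_simps)
  with Cons show ?case by (cases a) (simp add: tri_def)
qed

lemma tri_sum_swap: "tri K (\<lambda>x y z. \<Sum>i\<in>I. F x y z i) = (\<Sum>i\<in>I. tri K (\<lambda>x y z. F x y z i))"
  by (induction K) (auto simp: tri_def sum.distrib)

lemma tri_zero: "tri K (\<lambda>x y z. 0) = 0"
  by (induction K) (auto simp: tri_def)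

lemma tri_nth: "tri K F = (\<Sum>i<length K. F (fst (K ! i)) (fst (snd (K ! i))) (snd (snd (K ! i))))"
  by (simp add: tri_def sum_list_sum_nth case_prod_beta atLeast0LessThan)

text \<open>The comultiplication is \<open>\<Delta> a = (\<Sum>b\<in>Basis. b \<otimes> R b a)\<close>, and \<open>D F a\<close> stands for \<open>F a\<^sub>1 a\<^sub>2\<close>. Tensor
  identities are expressed by evaluating multilinear maps with values in the algebra.\<close>

locale sweedler_algebra = unital_algebra scale + finite_dimensional_vector_space scale Basis
  for scale :: "'k::field \<Rightarrow> 'a::ring_1 \<Rightarrow> 'a" (infixr "*s" 75) and Basis :: "'a set" +
  fixes R :: "'a \<Rightarrow> 'a \<Rightarrow> 'a"
  assumes R_linear: "\<And>b. Vector_Spaces.linear scale scale (R b)"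
begin

abbreviation lin :: "('a \<Rightarrow> 'a) \<Rightarrow> bool" where
  "lin \<equiv> Vector_Spaces.linear scale scale"

abbreviation ling :: "('a \<Rightarrow> 'k) \<Rightarrow> bool" where
  "ling \<equiv> Vector_Spaces.linear scale (*)"

lemma lin_iff: "lin f \<longleftrightarrow> (\<forall>x y. f (x + y) = f x + f y) \<and> (\<forall>c x. f (c *s x) = c *s f x)"
  using vector_space_axioms
  by (auto simp: Vector_Spaces.linear_def module_hom_def module_hom_axioms_def module_iff_vector_space)

lemma ling_iff: "ling f \<longleftrightarrow> (\<forall>x y. f (x + y) = f x + f y) \<and> (\<forall>c x. f (c *s x) = c * f x)"
  using vector_space_axioms vector_space_times
  by (auto simp: Vector_Spaces.linear_def module_hom_def module_hom_axioms_def module_iff_vector_space)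

definition D :: "('a \<Rightarrow> 'a \<Rightarrow> 'b::comm_monoid_add) \<Rightarrow> 'a \<Rightarrow> 'b" where
  "D F a = (\<Sum>b\<in>Basis. F b (R b a))"

lemma lin_zero: "lin f \<Longrightarrow> f 0 = 0"
  by (metis lin_iff scale_zero_left)

lemma lin_sum: "lin f \<Longrightarrow> f (sum g I) = (\<Sum>i\<in>I. f (g i))"
  by (induction I rule: infinite_finite_induct) (auto simp: lin_zero lin_iff)

lemma ling_zero: "ling f \<Longrightarrow> f 0 = 0"
  by (metis ling_iff scale_zero_left mult_zero_left)

lemma ling_sum: "ling f \<Longrightarrow> f (sum g I) = (\<Sum>i\<in>I. f (g i))"
  by (induction I rule: infinite_finite_induct) (auto simp: ling_zero ling_iff)

lemma D_push: "lin h \<Longrightarrow> h (D F a) = D (\<lambda>u v. h (F u v)) a"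
  by (simp add: D_def lin_sum)

lemma tri_push: "lin h \<Longrightarrow> h (tri K F) = tri K (\<lambda>x y z. h (F x y z))"
  by (induction K) (auto simp: tri_def lin_zero lin_iff)

lemma D_pushg: "ling h \<Longrightarrow> h (D F a) = D (\<lambda>u v. h (F u v)) a"
  by (simp add: D_def ling_sum)

lemma tri_pushg: "ling h \<Longrightarrow> h (tri K F) = tri K (\<lambda>x y z. h (F x y z))"
  by (induction K) (auto simp: tri_def ling_zero ling_iff)

lemma D_swap: "D (\<lambda>u v. D (F u v) b) a = D (\<lambda>u' v'. D (\<lambda>u v. F u v u' v') a) b"
  unfolding D_def by (rule sum.swap)

lemma tri_D_swap: "tri K (\<lambda>x y z. D (F x y z) a) = D (\<lambda>u v. tri K (\<lambda>x y z. F x y z u v)) a"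
  unfolding D_def by (rule tri_sum_swap)

lemma lin_scale: "lin f \<Longrightarrow> f (c *s x) = c *s f x"
  by (simp add: lin_iff)

lemma lin_idI [lin_intros]: "lin (\<lambda>x. x)"
  by (simp add: lin_iff)

lemma lin_multI [lin_intros]:
  "lin f \<Longrightarrow> lin (\<lambda>x. f x * a)" "lin f \<Longrightarrow> lin (\<lambda>x. a * f x)"
  by (simp_all add: lin_iff scale_mult_left scale_mult_right algebra_simps)

lemma lin_scaleI [lin_intros]:
  "lin f \<Longrightarrow> lin (\<lambda>x. c *s f x)" "ling g \<Longrightarrow> lin (\<lambda>x. g x *s a)"
  by (simp_all add: lin_iff ling_iff algebra_simps)

lemma ling_multI [lin_intros]:
  "ling f \<Longrightarrow> ling (\<lambda>x. f x * a)" "ling f \<Longrightarrow> ling (\<lambda>x. a * f x)"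
  by (simp_all add: ling_iff algebra_simps)

lemma ling_compI: "ling g \<Longrightarrow> lin f \<Longrightarrow> ling (\<lambda>x. g (f x))"
  by (simp add: lin_iff ling_iff)

lemma lin_compI: "lin g \<Longrightarrow> lin f \<Longrightarrow> lin (\<lambda>x. g (f x))"
  by (simp add: lin_iff)

lemma lin_sumI [lin_intros]: "(\<And>i. lin (\<lambda>x. F x i)) \<Longrightarrow> lin (\<lambda>x. \<Sum>i\<in>I. F x i)"
  by (simp add: lin_iff sum.distrib scale_sum_right)

lemma lin_D_funI [lin_intros]: "(\<And>u v. lin (\<lambda>x. F x u v)) \<Longrightarrow> lin (\<lambda>x. D (\<lambda>u v. F x u v) a)"
  unfolding D_def by (rule lin_sumI)

lemma lin_D_argI [lin_intros]: "(\<And>u. lin (F u)) \<Longrightarrow> lin g \<Longrightarrow> lin (\<lambda>x. D F (g x))"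
  unfolding D_def using R_linear by (intro lin_sumI) (simp add: lin_iff)

lemma lin_triI [lin_intros]: "(\<And>u v w. lin (\<lambda>x. F x u v w)) \<Longrightarrow> lin (\<lambda>x. tri K (\<lambda>u v w. F x u v w))"
  by (induction K) (auto simp: lin_iff tri_def algebra_simps)

definition lin2 :: "('a \<Rightarrow> 'a \<Rightarrow> 'a) \<Rightarrow> bool" where
  "lin2 F \<longleftrightarrow> (\<forall>b. lin (\<lambda>a. F a b)) \<and> (\<forall>a. lin (\<lambda>b. F a b))"

definition lin3 :: "('a \<Rightarrow> 'a \<Rightarrow> 'a \<Rightarrow> 'a) \<Rightarrow> bool" where
  "lin3 F \<longleftrightarrow> (\<forall>b c. lin (\<lambda>a. F a b c)) \<and> (\<forall>a c. lin (\<lambda>b. F a b c)) \<and>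
     (\<forall>a b. lin (\<lambda>c. F a b c))"

definition lin4 :: "('a \<Rightarrow> 'a \<Rightarrow> 'a \<Rightarrow> 'a \<Rightarrow> 'a) \<Rightarrow> bool" where
  "lin4 F \<longleftrightarrow> (\<forall>b c d. lin (\<lambda>a. F a b c d)) \<and> (\<forall>a c d. lin (\<lambda>b. F a b c d)) \<and>
     (\<forall>a b d. lin (\<lambda>c. F a b c d)) \<and> (\<forall>a b c. lin (\<lambda>d. F a b c d))"

lemma lin2I [lin_intros]: "\<lbrakk>\<And>b. lin (\<lambda>a. F a b); \<And>a. lin (\<lambda>b. F a b)\<rbrakk> \<Longrightarrow> lin2 F"
  by (simp add: lin2_def)

lemma lin3I [lin_intros]:
  "\<lbrakk>\<And>b c. lin (\<lambda>a. F a b c); \<And>a c. lin (\<lambda>b. F a b c); \<And>a b. lin (\<lambda>c. F a b c)\<rbrakk> \<Longrightarrow> lin3 F"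
  by (simp add: lin3_def)

lemma lin4I [lin_intros]:
  "\<lbrakk>\<And>b c d. lin (\<lambda>a. F a b c d); \<And>a c d. lin (\<lambda>b. F a b c d); \<And>a b d. lin (\<lambda>c. F a b c d);
    \<And>a b c. lin (\<lambda>d. F a b c d)\<rbrakk> \<Longrightarrow> lin4 F"
  by (simp add: lin4_def)

text \<open>The linear map \<open>g\<close> inside the argument lets introduction rules descend
  through nested terms in which an abstract multilinear \<open>F\<close> is the head.\<close>

lemma lin2D:
  assumes "lin2 F"
  shows "lin g \<Longrightarrow> lin (\<lambda>x. F (g x) b)" "lin g \<Longrightarrow> lin (\<lambda>x. F a (g x))"
  using assms by (simp_all add: lin2_def lin_iff)

lemma lin3D:
  assumes "lin3 F"
  shows "lin g \<Longrightarrow> lin (\<lambda>x. F (g x) b c)" "lin g \<Longrightarrow> lin (\<lambda>x. F a (g x) c)"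
    "lin g \<Longrightarrow> lin (\<lambda>x. F a b (g x))"
  using assms by (simp_all add: lin3_def lin_iff)

lemma lin4D:
  assumes "lin4 F"
  shows "lin g \<Longrightarrow> lin (\<lambda>x. F (g x) b c d)" "lin g \<Longrightarrow> lin (\<lambda>x. F a (g x) c d)"
    "lin g \<Longrightarrow> lin (\<lambda>x. F a b (g x) d)" "lin g \<Longrightarrow> lin (\<lambda>x. F a b c (g x))"
  using assms by (simp_all add: lin4_def lin_iff)

lemma mult_D: "x * D F a = D (\<lambda>u v. x * F u v) a"
  and scale_D: "c *s D F a = D (\<lambda>u v. c *s F u v) a"
  by (simp_all add: D_def sum_distrib_left scale_sum_right)

lemma mult_tri: "x * tri K F = tri K (\<lambda>u v w. x * F u v w)"
  and scale_tri: "c *s tri K F = tri K (\<lambda>u v w. c *s F u v w)"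
  by (rule tri_push; intro lin_intros)+

abbreviation coord :: "'a \<Rightarrow> 'a \<Rightarrow> 'k" where "coord b x \<equiv> representation Basis x b"

lemma coord_linear [lin_intros]: "ling (coord b)"
  by (simp add: ling_iff representation_add representation_scale independent_Basis span_Basis)

lemma coord_expand: "(\<Sum>b\<in>Basis. coord b x *s b) = x"
  by (rule sum_representation_eq) (simp_all add: independent_Basis span_Basis finite_Basis)

lemma coord_expandg: "ling g \<Longrightarrow> g x = (\<Sum>m\<in>Basis. coord m x * g m)"
  by (subst (1) coord_expand[of x, symmetric]) (simp add: ling_sum, simp add: ling_iff)

text \<open>A vector outside \<open>range C\<close> can be added to a basis of
  \<open>range C\<close>; the functional that is 1 on it and 0 on that basis kills
  \<open>range C\<close> without being zero.\<close>

lemma functionals_vanish_imp_surj: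
  assumes C: "lin C" and h: "\<And>h y. ling h \<Longrightarrow> (\<And>x. h (C x) = 0) \<Longrightarrow> h y = 0"
  shows "surj C"
proof (rule ccontr)
  assume "\<not> surj C"
  then obtain v where v: "v \<notin> range C" by blast
  interpret C: Vector_Spaces.linear scale scale C by fact
  interpret P: vector_space_pair scale "(*) :: 'k \<Rightarrow> 'k \<Rightarrow> 'k"
    by (intro vector_space_pair.intro vector_space_axioms vector_space_times)
  obtain A where A: "A \<subseteq> range C" "independent A" "range C \<subseteq> span A"
    by (rule maximal_independent_subset)
  have "span A \<subseteq> range C"
    by (rule span_minimal[OF A(1)]) (simp add: C.subspace_image)
  with v have vA: "v \<notin> span A" by blast
  then have "v \<notin> A" using span_base by blast
  have "independent (insert v A)" by (rule independent_insertI[OF vA A(2)])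
  from P.linear_independent_extend[OF this, of "\<lambda>x. if x = v then 1 else 0"]
  obtain g where g: "ling g" "g v = 1" "\<And>x. x \<in> A \<Longrightarrow> g x = 0"
    using \<open>v \<notin> A\<close> by (metis insert_iff)
  have "g (C x) = 0" for x
    using P.linear_eq_0_on_span[OF g(1), of A "C x"] g(3) A(3) by blast
  from h[OF g(1) this] g(2) show False by simp
qed

lemma ling_eqI: "(\<And>g. ling g \<Longrightarrow> g x = g y) \<Longrightarrow> x = y"
  by (rule functionals_separate[OF vector_space_axioms])

text \<open>Finite dimension makes the injective left multiplication surjective, which gives a right
  inverse; cancelling \<open>t\<close> in \<open>t * (t' * t) = t * 1\<close> makes it
  two-sided.\<close>

lemma left_mult_inj_imp_unit:
  fixes t :: 'a
  assumes "\<And>b. t * b = 0 \<Longrightarrow> b = 0"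
  obtains t' where "t * t' = 1" "t' * t = 1"
proof -
  have "lin (\<lambda>b. t * b)" by (intro lin_intros)
  moreover have inj: "inj (\<lambda>b. t * b)"
  proof (rule injI)
    fix a b assume "t * a = t * b"
    then have "t * (a - b) = 0" by (simp add: right_diff_distrib)
    then show "a = b" using assms by force
  qed
  ultimately have "surj (\<lambda>b. t * b)" by (rule linear_inj_imp_surj)
  then obtain t' where t': "t * t' = 1" by (metis surjD)
  have "t * (t' * t) = t * 1" by (simp add: mult.assoc[symmetric] t')
  then have "t' * t = 1" using inj by (rule injD[rotated])
  with t' that show ?thesis by blast
qed

end

locale sweedler_quasi_hopf = sweedler_algebra scale Basis R
  for scale :: "'k::field \<Rightarrow> 'a::ring_1 \<Rightarrow> 'a" (infixr "*s" 75) and Basis R +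
  fixes \<epsilon> :: "'a \<Rightarrow> 'k" and \<Phi> \<Psi> :: "('a \<times> 'a \<times> 'a) list" and S :: "'a \<Rightarrow> 'a" and \<alpha> \<beta> :: 'a
  assumes D_one: "\<And>F. lin2 F \<Longrightarrow> D F 1 = F 1 1"
    and D_mult: "\<And>F a b. lin2 F \<Longrightarrow> D F (a * b) = D (\<lambda>u v. D (\<lambda>u' v'. F (u * u') (v * v')) b) a"
    and eps_linear: "ling \<epsilon>" and eps_one: "\<epsilon> 1 = 1" and eps_mult: "\<And>a b. \<epsilon> (a * b) = \<epsilon> a * \<epsilon> b"
    and \<Phi>\<Psi>: "\<And>F. lin3 F \<Longrightarrow> tri \<Phi> (\<lambda>X Y Z. tri \<Psi> (\<lambda>x y z. F (X * x) (Y * y) (Z * z))) = F 1 1 1"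
    and \<Psi>\<Phi>: "\<And>F. lin3 F \<Longrightarrow> tri \<Psi> (\<lambda>x y z. tri \<Phi> (\<lambda>X Y Z. F (x * X) (y * Y) (z * Z))) = F 1 1 1"
    and coassoc: "\<And>F a. lin3 F \<Longrightarrow>
       D (\<lambda>u v. D (\<lambda>v1 v2. tri \<Phi> (\<lambda>X Y Z. F (u * X) (v1 * Y) (v2 * Z))) v) a =
       tri \<Phi> (\<lambda>X Y Z. D (\<lambda>u v. D (\<lambda>u1 u2. F (X * u1) (Y * u2) (Z * v)) u) a)"
    and pentagon: "\<And>F. lin4 F \<Longrightarrow>
       tri \<Phi> (\<lambda>X Y Z. D (\<lambda>Z1 Z2. tri \<Phi> (\<lambda>X' Y' Z'.
         D (\<lambda>X1 X2. F (X * X1) (Y * X2) (Z1 * Y') (Z2 * Z')) X')) Z) =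
       tri \<Phi> (\<lambda>X Y Z. tri \<Phi> (\<lambda>X' Y' Z'. D (\<lambda>Y1 Y2. tri \<Phi> (\<lambda>X'' Y'' Z''.
         F (X' * X'') (X * Y1 * Y'') (Y * Y2 * Z'') (Z * Z'))) Y'))"
    and counit_left: "\<And>a. D (\<lambda>u v. \<epsilon> u *s v) a = a"
    and counit_right: "\<And>a. D (\<lambda>u v. \<epsilon> v *s u) a = a"
    and eps_assoc: "\<And>F. lin2 F \<Longrightarrow> tri \<Phi> (\<lambda>X Y Z. \<epsilon> Y *s F X Z) = F 1 1"
    and S_linear: "lin S" and S_one: "S 1 = 1" and S_mult: "\<And>a b. S (a * b) = S b * S a" and S_bij: "bij S"
    and S_left: "\<And>a. D (\<lambda>u v. S u * \<alpha> * v) a = \<epsilon> a *s \<alpha>"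
    and S_right: "\<And>a. D (\<lambda>u v. u * \<beta> * S v) a = \<epsilon> a *s \<beta>"
    and S_assoc: "tri \<Phi> (\<lambda>X Y Z. X * \<beta> * S Y * \<alpha> * Z) = 1"
    and S_assoc_inv: "tri \<Psi> (\<lambda>X Y Z. S X * \<alpha> * Y * \<beta> * S Z) = 1"
    and eps_alpha: "\<epsilon> \<alpha> = 1" and eps_beta: "\<epsilon> \<beta> = 1"
begin

lemmas [lin_intros] = lin_compI[OF S_linear] ling_compI[OF eps_linear]

lemma S_scale: "S (c *s x) = c *s S x"
  using S_linear by (simp add: lin_iff)

lemma eps_scale: "\<epsilon> (c *s x) = c * \<epsilon> x"
  using eps_linear by (simp add: ling_iff)

lemma counit_left_lin: "lin f \<Longrightarrow> D (\<lambda>u v. \<epsilon> u *s f v) a = f a"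
  using D_push[of f "\<lambda>u v. \<epsilon> u *s v" a] by (simp add: counit_left lin_iff)

lemma counit_right_lin: "lin f \<Longrightarrow> D (\<lambda>u v. \<epsilon> v *s f u) a = f a"
  using D_push[of f "\<lambda>u v. \<epsilon> v *s u" a] by (simp add: counit_right lin_iff)

lemma S_left_lin: "lin f \<Longrightarrow> D (\<lambda>u v. f (S u * \<alpha> * v)) a = \<epsilon> a *s f \<alpha>"
  using D_push[of f "\<lambda>u v. S u * \<alpha> * v" a] by (simp add: S_left lin_iff)

lemma S_right_lin: "lin f \<Longrightarrow> D (\<lambda>u v. f (u * \<beta> * S v)) a = \<epsilon> a *s f \<beta>"
  using D_push[of f "\<lambda>u v. u * \<beta> * S v" a] by (simp add: S_right lin_iff)

text \<open>The five factors of the pentagon, in the order in which they occur in it, as operators on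
  4-linear maps; the product of tensors \<open>s\<close> and \<open>t\<close> acts as \<open>\<lambda>F. s (\<lambda>a b c d. t (m4 F a b c d))\<close>.\<close>

definition op1 where "op1 K F = tri K (\<lambda>x y z. D (\<lambda>z1 z2. F x y z1 z2) z)"
definition op2 where "op2 K F = tri K (\<lambda>x y z. D (\<lambda>u v. F u v y z) x)"
definition op3 where "op3 K F = tri K (\<lambda>x y z. F 1 x y z)"
definition op4 where "op4 K F = tri K (\<lambda>x y z. D (\<lambda>u v. F x u v z) y)"
definition op5 where "op5 K F = tri K (\<lambda>x y z. F x y z 1)"
definition m4 :: "('a \<Rightarrow> 'a \<Rightarrow> 'a \<Rightarrow> 'a \<Rightarrow> 'a) \<Rightarrow> 'a \<Rightarrow> 'a \<Rightarrow> 'a \<Rightarrow> 'a \<Rightarrow> 'a \<Rightarrow> 'a \<Rightarrow> 'a \<Rightarrow> 'a \<Rightarrow> 'a"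
  where "m4 F a b c d = (\<lambda>a' b' c' d'. F (a * a') (b * b') (c * c') (d * d'))"
lemmas op_defs = op1_def op2_def op3_def op4_def op5_def

lemma m4_m4: "m4 (m4 F a b c d) a' b' c' d' = m4 F (a * a') (b * b') (c * c') (d * d')"
  by (simp add: m4_def mult.assoc)

lemma lin4_m4:
  assumes "lin4 F"
  shows "lin4 (m4 F a b c d)"
  unfolding m4_def by (intro lin_intros lin4D[OF assms])

lemma lin4_op:
  assumes "lin4 F"
  shows "lin4 (\<lambda>a b c d. op2 K (m4 F a b c d))" "lin4 (\<lambda>a b c d. op4 K (m4 F a b c d))" "lin4 (\<lambda>a b c d. op5 K (m4 F a b c d))"
  unfolding op_defs m4_def by (intro lin_intros lin4D[OF assms])+

lemma pentagon': "lin4 F \<Longrightarrow> op1 \<Phi> (\<lambda>a b c d. op2 \<Phi> (m4 F a b c d)) =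
  op3 \<Phi> (\<lambda>a b c d. op4 \<Phi> (\<lambda>a' b' c' d'. op5 \<Phi> (m4 (m4 F a b c d) a' b' c' d')))"
  using pentagon[of F] by (simp add: op_defs m4_def mult.assoc)

section \<open>Consequences of the pentagon\<close>

text \<open>Since \<Delta> is a unital algebra morphism, applying it to one leg of \<phi> and of
  \<phi>^-1, or adding a unit leg to both, keeps them inverse to each other.\<close>

lemma op_inv:
  assumes F: "lin4 F"
  shows "op1 \<Psi> (\<lambda>a b c d. op1 \<Phi> (m4 F a b c d)) = F 1 1 1 1"
    and "op2 \<Phi> (\<lambda>a b c d. op2 \<Psi> (m4 F a b c d)) = F 1 1 1 1"
    and "op3 \<Psi> (\<lambda>a b c d. op3 \<Phi> (m4 F a b c d)) = F 1 1 1 1"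
    and "op4 \<Psi> (\<lambda>a b c d. op4 \<Phi> (m4 F a b c d)) = F 1 1 1 1"
    and "op5 \<Phi> (\<lambda>a b c d. op5 \<Psi> (m4 F a b c d)) = F 1 1 1 1"
proof -
  note [lin_intros] = lin4D[OF F]
  have l1: "lin3 (\<lambda>x y z. D (\<lambda>u v. F x y u v) z)" by (intro lin_intros)
  have l2: "lin3 (\<lambda>x y z. D (\<lambda>u v. F u v y z) x)" by (intro lin_intros)
  have l4: "lin3 (\<lambda>x y z. D (\<lambda>u v. F x u v z) y)" by (intro lin_intros)
  have m1: "D (F x y) (a * b) = D (\<lambda>u v. D (\<lambda>u' v'. F x y (u * u') (v * v')) b) a" for x y a b
    by (rule D_mult) (intro lin_intros)
  have m2: "D (\<lambda>u v. F u v x y) (a * b) = D (\<lambda>u v. D (\<lambda>u' v'. F (u * u') (v * v') x y) b) a" for x y a b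
    by (rule D_mult) (intro lin_intros)
  have m4: "D (\<lambda>u v. F x u v y) (a * b) = D (\<lambda>u v. D (\<lambda>u' v'. F x (u * u') (v * v') y) b) a" for x y a b
    by (rule D_mult) (intro lin_intros)
  have o1: "D (F x y) 1 = F x y 1 1" for x y by (rule D_one) (intro lin_intros)
  have o2: "D (\<lambda>u v. F u v x y) 1 = F 1 1 x y" for x y by (rule D_one) (intro lin_intros)
  have o4: "D (\<lambda>u v. F x u v y) 1 = F x 1 1 y" for x y by (rule D_one) (intro lin_intros)
  show "op1 \<Psi> (\<lambda>a b c d. op1 \<Phi> (m4 F a b c d)) = F 1 1 1 1"
    using \<Psi>\<Phi>[OF l1] unfolding op1_def m4_def m1 o1 tri_D_swap .
  show "op2 \<Phi> (\<lambda>a b c d. op2 \<Psi> (m4 F a b c d)) = F 1 1 1 1"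
    using \<Phi>\<Psi>[OF l2] unfolding op2_def m4_def m2 o2 tri_D_swap .
  show "op4 \<Psi> (\<lambda>a b c d. op4 \<Phi> (m4 F a b c d)) = F 1 1 1 1"
    using \<Psi>\<Phi>[OF l4] unfolding op4_def m4_def m4 o4 tri_D_swap .
  have l3: "lin3 (F 1)" by (intro lin_intros)
  have l5: "lin3 (\<lambda>x y z. F x y z 1)" by (intro lin_intros)
  show "op3 \<Psi> (\<lambda>a b c d. op3 \<Phi> (m4 F a b c d)) = F 1 1 1 1"
    using \<Psi>\<Phi>[OF l3] by (simp add: op3_def m4_def)
  show "op5 \<Phi> (\<lambda>a b c d. op5 \<Psi> (m4 F a b c d)) = F 1 1 1 1"
    using \<Phi>\<Psi>[OF l5] by (simp add: op5_def m4_def)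
qed

text \<open>The outer factors of the pentagon change sides: multiply by the inverse of
  \<open>op1 \<Phi>\<close> on the left and by the inverse of \<open>op5 \<Phi>\<close> on the
  right.\<close>

lemma pentagon_inv1:
  assumes F: "lin4 F"
  shows "op2 \<Phi> (\<lambda>a b c d. op5 \<Psi> (m4 F a b c d)) =
    op1 \<Psi> (\<lambda>a b c d. op3 \<Phi> (\<lambda>a' b' c' d'. op4 \<Phi> (m4 (m4 F a b c d) a' b' c' d')))"
proof -
  define G where "G = (\<lambda>a b c d. op5 \<Psi> (m4 F a b c d))"
  have G: "lin4 G" unfolding G_def by (rule lin4_op[OF F])
  \<comment> \<open>Multiplying \<open>G\<close> by \<phi> \<otimes> 1 undoes the \<phi>^-1
    \<otimes> 1 in its definition; this supplies the last factor that the pentagon needs.\<close>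
  have FG: "F a b c d = op5 \<Phi> (m4 G a b c d)" for a b c d
    using op_inv(5)[OF lin4_m4[OF F], of a b c d] by (simp add: G_def m4_m4) (simp add: m4_def G_def)
  have "op1 \<Psi> (\<lambda>a b c d. op3 \<Phi> (\<lambda>a' b' c' d'. op4 \<Phi> (m4 (m4 F a b c d) a' b' c' d'))) =
     op1 \<Psi> (\<lambda>a b c d. op3 \<Phi> (\<lambda>a' b' c' d'. op4 \<Phi> (\<lambda>e f g h.
        op5 \<Phi> (m4 (m4 (m4 G a b c d) a' b' c' d') e f g h))))"
    by (simp add: m4_m4) (simp add: m4_def[of F] FG)
  also have "\<dots> = op1 \<Psi> (\<lambda>a b c d. op1 \<Phi> (m4 (\<lambda>a b c d. op2 \<Phi> (m4 G a b c d)) a b c d))"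
    unfolding pentagon'[OF lin4_m4[OF G], symmetric] by (simp add: m4_m4) (simp add: m4_def)
  also have "\<dots> = op2 \<Phi> (m4 G 1 1 1 1)"
    by (rule op_inv(1)[OF lin4_op(1)[OF G]])
  also have "\<dots> = op2 \<Phi> G" by (simp add: m4_def)
  finally show ?thesis by (simp add: G_def)
qed

text \<open>Now \<open>op2 \<Phi>\<close> is cancelled on the right, and the product of
  \<open>op3 \<Phi>\<close> and \<open>op4 \<Phi>\<close> on the left; its inverse is the product of
  \<open>op4 \<Psi>\<close> and \<open>op3 \<Psi>\<close> in this order.\<close>

lemma pentagon_inv2:
  assumes F: "lin4 F"
  shows "op5 \<Phi> (\<lambda>a b c d. op2 \<Psi> (m4 F a b c d)) =
    op4 \<Psi> (\<lambda>a b c d. op3 \<Psi> (\<lambda>a' b' c' d'. op1 \<Phi> (m4 (m4 F a b c d) a' b' c' d')))"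
proof -
  define G where "G = (\<lambda>a b c d. op2 \<Psi> (m4 F a b c d))"
  have G: "lin4 G" unfolding G_def by (rule lin4_op[OF F])
  have FG: "F a b c d = op2 \<Phi> (m4 G a b c d)" for a b c d
    using op_inv(2)[OF lin4_m4[OF F], of a b c d] by (simp add: G_def m4_m4) (simp add: m4_def G_def)
  let ?H = "\<lambda>a b c d. op4 \<Phi> (m4 (\<lambda>a b c d. op5 \<Phi> (m4 G a b c d)) a b c d)"
  have "op4 \<Psi> (\<lambda>a b c d. op3 \<Psi> (\<lambda>a' b' c' d'. op1 \<Phi> (m4 (m4 F a b c d) a' b' c' d'))) =
     op4 \<Psi> (\<lambda>a b c d. op3 \<Psi> (\<lambda>a' b' c' d'. op1 \<Phi> (\<lambda>e f g h.
        op2 \<Phi> (m4 (m4 (m4 G a b c d) a' b' c' d') e f g h))))"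
    by (simp add: m4_m4) (simp add: m4_def[of F] FG)
  also have "\<dots> = op4 \<Psi> (\<lambda>a b c d. op3 \<Psi> (\<lambda>a' b' c' d'.
     op3 \<Phi> (m4 (m4 ?H a b c d) a' b' c' d')))"
    unfolding pentagon'[OF lin4_m4[OF lin4_m4[OF G]]] by (simp add: m4_m4) (simp add: m4_def mult.assoc)
  also have "\<dots> = op4 \<Psi> (\<lambda>a b c d. m4 ?H a b c d 1 1 1 1)"
    by (subst op_inv(3)) (intro lin4_m4 lin4_op G refl)+
  also have "\<dots> = op4 \<Psi> ?H" by (simp add: m4_def)
  also have "\<dots> = op5 \<Phi> (m4 G 1 1 1 1)"
    by (rule op_inv(4)[OF lin4_op(3)[OF G]])
  also have "\<dots> = op5 \<Phi> G" by (simp add: m4_def)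
  finally show ?thesis by (simp add: G_def)
qed

text \<open>Multiply \<open>coassoc\<close> by \<phi>^-1 on both sides. Expressing \<open>F\<close>
  through \<open>G\<close> creates the factor \<phi> on the right that the axiom requires.\<close>

lemma coassoc_inv:
  assumes F: "lin3 F"
  shows "D (\<lambda>u v. D (\<lambda>u1 u2. tri \<Psi> (\<lambda>x y z. F (u1 * x) (u2 * y) (v * z))) u) a =
       tri \<Psi> (\<lambda>x y z. D (\<lambda>u v. D (\<lambda>v1 v2. F (x * u) (y * v1) (z * v2)) v) a)"
proof -
  note [lin_intros] = lin3D[OF F]
  define G where "G p q r = tri \<Psi> (\<lambda>x y z. F (p * x) (q * y) (r * z))" for p q r
  have G: "lin3 G" unfolding G_def by (intro lin_intros)
  have FG: "F p q r = tri \<Phi> (\<lambda>X Y Z. G (p * X) (q * Y) (r * Z))" for p q r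
  proof -
    have "lin3 (\<lambda>x y z. F (p * x) (q * y) (r * z))" by (intro lin_intros)
    from \<Phi>\<Psi>[OF this] show ?thesis by (simp add: G_def mult.assoc)
  qed
  have "tri \<Psi> (\<lambda>x y z. D (\<lambda>u v. D (\<lambda>v1 v2. F (x * u) (y * v1) (z * v2)) v) a) =
     tri \<Psi> (\<lambda>x y z. D (\<lambda>u v. D (\<lambda>v1 v2. tri \<Phi> (\<lambda>X Y Z. G (x * (u * X)) (y * (v1 * Y)) (z * (v2 * Z)))) v) a)"
    by (simp add: FG mult.assoc)
  also have "\<dots> = tri \<Psi> (\<lambda>x y z. tri \<Phi> (\<lambda>X Y Z. D (\<lambda>u v. D (\<lambda>u1 u2.
      G (x * X * u1) (y * Y * u2) (z * Z * v)) u) a))"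
    by (subst coassoc[of "\<lambda>p q r. G (_ * p) (_ * q) (_ * r)"])
      (intro lin_intros lin3D[OF G], simp add: mult.assoc)
  also have "\<dots> = D (\<lambda>u v. D (\<lambda>u1 u2. G (1 * u1) (1 * u2) (1 * v)) u) a"
    by (rule \<Psi>\<Phi>[where F="\<lambda>x y z. D (\<lambda>u v. D (\<lambda>u1 u2. G (x * u1) (y * u2) (z * v)) u) a"])
      (intro lin_intros lin3D[OF G])
  finally show ?thesis by (simp add: G_def)
qed

section \<open>Commutation rules for q and p\<close>

lemma Q_move:
  assumes F: "lin2 F"
  shows "D (\<lambda>u v. D (\<lambda>u1 u2. tri \<Phi> (\<lambda>X Y Z. F (X * u1) (S (Y * u2) * \<alpha> * Z * v))) u) a =
     tri \<Phi> (\<lambda>X Y Z. F (a * X) (S Y * \<alpha> * Z))"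
proof -
  note [lin_intros] = lin2D[OF F]
  have "D (\<lambda>u v. D (\<lambda>u1 u2. tri \<Phi> (\<lambda>X Y Z. F (X * u1) (S (Y * u2) * \<alpha> * Z * v))) u) a =
      tri \<Phi> (\<lambda>X Y Z. D (\<lambda>u v. D (\<lambda>u1 u2. F (X * u1) (S (Y * u2) * \<alpha> * (Z * v))) u) a)"
    by (simp add: tri_D_swap mult.assoc)
  also have "\<dots> = D (\<lambda>u v. D (\<lambda>v1 v2. tri \<Phi> (\<lambda>X Y Z. F (u * X) (S (v1 * Y) * \<alpha> * (v2 * Z)))) v) a"
    by (rule coassoc[symmetric]) (intro lin_intros)
  \<comment> \<open>Quasi-coassociativity has placed both legs of \<open>v\<close> next to \<alpha>,
    where the antipode axiom contracts them to \<open>\<epsilon> v\<close>. In a Hopf algebra this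
    is \<open>a\<^sub>1 \<otimes> S(a\<^sub>2) a\<^sub>3 = a \<otimes> 1\<close>.\<close>
  also have "\<dots> = D (\<lambda>u v. tri \<Phi> (\<lambda>X Y Z. D (\<lambda>v1 v2. F (u * X) (S Y * (S v1 * \<alpha> * v2) * Z)) v)) a"
    by (simp add: tri_D_swap S_mult mult.assoc)
  also have "\<dots> = D (\<lambda>u v. tri \<Phi> (\<lambda>X Y Z. \<epsilon> v *s F (u * X) (S Y * \<alpha> * Z))) a"
    by (subst S_left_lin) (intro lin_intros refl)+
  also have "\<dots> = D (\<lambda>u v. \<epsilon> v *s tri \<Phi> (\<lambda>X Y Z. F (u * X) (S Y * \<alpha> * Z))) a"
    by (simp add: scale_tri)
  also have "\<dots> = tri \<Phi> (\<lambda>X Y Z. F (a * X) (S Y * \<alpha> * Z))"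
    by (rule counit_right_lin) (intro lin_intros)
  finally show ?thesis .
qed

text \<open>The mirror image of \<open>Q_move\<close>: \<phi>^-1 brings two legs of \<open>a\<close>
  together around \<beta>. In a Hopf algebra this is
  \<open>a\<^sub>1 \<otimes> a\<^sub>2 S(a\<^sub>3) = a \<otimes> 1\<close>.\<close>

lemma P_move:
  assumes F: "lin2 F"
  shows "D (\<lambda>u v. D (\<lambda>u1 u2. tri \<Psi> (\<lambda>x y z. F (u1 * x) (u2 * y * \<beta> * S (v * z)))) u) a =
     tri \<Psi> (\<lambda>x y z. F (x * a) (y * \<beta> * S z))"
proof -
  note [lin_intros] = lin2D[OF F]
  have "D (\<lambda>u v. D (\<lambda>u1 u2. tri \<Psi> (\<lambda>x y z. F (u1 * x) (u2 * y * \<beta> * S (v * z)))) u) a =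
      tri \<Psi> (\<lambda>x y z. D (\<lambda>u v. D (\<lambda>v1 v2. F (x * u) (y * v1 * \<beta> * S (z * v2))) v) a)"
    by (rule coassoc_inv) (intro lin_intros)
  also have "\<dots> = tri \<Psi> (\<lambda>x y z. D (\<lambda>u v. D (\<lambda>v1 v2. F (x * u) (y * (v1 * \<beta> * S v2) * S z)) v) a)"
    by (simp add: S_mult mult.assoc)
  also have "\<dots> = tri \<Psi> (\<lambda>x y z. D (\<lambda>u v. \<epsilon> v *s F (x * u) (y * \<beta> * S z)) a)"
    by (subst S_right_lin) (intro lin_intros refl)+
  also have "\<dots> = tri \<Psi> (\<lambda>x y z. F (x * a) (y * \<beta> * S z))"
    by (subst counit_right_lin) (intro lin_intros refl)+
  finally show ?thesis .
qed

text \<open>With \<epsilon> on its third leg the pentagon collapses: two factors become trivial by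
  \<open>eps_assoc\<close>, two become \<phi>, and \<phi> equals \<phi> times the wanted element
  with a unit leg added. Then \<phi> is cancelled on the left.\<close>

lemma eps_assoc_right:
  assumes F: "lin2 F"
  shows "tri \<Phi> (\<lambda>X Y Z. \<epsilon> Z *s F X Y) = F 1 1"
proof -
  note [lin_intros] = lin2D[OF F]
  have *: "tri \<Phi> G = tri \<Phi> (\<lambda>X Y Z. tri \<Phi> (\<lambda>p q r. \<epsilon> r *s G (X * p) (Y * q) Z))"
    if G: "lin3 G" for G
  proof -
    note [lin_intros] = lin3D[OF G]
    have "lin4 (\<lambda>a b c d. \<epsilon> c *s G a b d)" by (intro lin_intros)
    note pentagon[OF this]
    also have "tri \<Phi> (\<lambda>X Y Z. D (\<lambda>Z1 Z2. tri \<Phi> (\<lambda>X' Y' Z'.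
         D (\<lambda>X1 X2. \<epsilon> (Z1 * Y') *s G (X * X1) (Y * X2) (Z2 * Z')) X')) Z) =
       tri \<Phi> (\<lambda>X Y Z. D (\<lambda>Z1 Z2. tri \<Phi> (\<lambda>X' Y' Z'.
         \<epsilon> Y' *s (\<epsilon> Z1 *s D (\<lambda>X1 X2. G (X * X1) (Y * X2) (Z2 * Z')) X'))) Z)"
      by (simp add: eps_mult scale_D mult.commute)
    also have "\<dots> = tri \<Phi> (\<lambda>X Y Z. D (\<lambda>Z1 Z2. \<epsilon> Z1 *s D (\<lambda>X1 X2. G (X * X1) (Y * X2) (Z2 * 1)) 1) Z)"
      by (subst eps_assoc) (intro lin_intros refl)+
    also have "\<dots> = tri \<Phi> (\<lambda>X Y Z. D (\<lambda>Z1 Z2. \<epsilon> Z1 *s G X Y Z2) Z)"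
      by (subst D_one) (intro lin_intros, simp)
    also have "\<dots> = tri \<Phi> G"
      by (subst counit_left_lin) (intro lin_intros refl)+
    also have "tri \<Phi> (\<lambda>X Y Z. tri \<Phi> (\<lambda>X' Y' Z'. D (\<lambda>Y1 Y2. tri \<Phi> (\<lambda>X'' Y'' Z''.
         \<epsilon> (Y * Y2 * Z'') *s G (X' * X'') (X * Y1 * Y'') (Z * Z'))) Y')) =
       tri \<Phi> (\<lambda>X Y Z. \<epsilon> Y *s tri \<Phi> (\<lambda>X' Y' Z'. D (\<lambda>Y1 Y2. \<epsilon> Y2 *s tri \<Phi> (\<lambda>X'' Y'' Z''.
         \<epsilon> Z'' *s G (X' * X'') (X * Y1 * Y'') (Z * Z'))) Y'))"
      by (simp add: eps_mult scale_D scale_tri mult.assoc)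
    also have "\<dots> = tri \<Phi> (\<lambda>X' Y' Z'. D (\<lambda>Y1 Y2. \<epsilon> Y2 *s tri \<Phi> (\<lambda>X'' Y'' Z''.
         \<epsilon> Z'' *s G (X' * X'') (1 * Y1 * Y'') (1 * Z'))) Y')"
      by (rule eps_assoc) (intro lin_intros)
    also have "\<dots> = tri \<Phi> (\<lambda>X' Y' Z'. tri \<Phi> (\<lambda>X'' Y'' Z''. \<epsilon> Z'' *s G (X' * X'') (1 * Y' * Y'') (1 * Z')))"
      by (subst counit_right_lin) (intro lin_intros refl)+
    finally show ?thesis by simp
  qed
  have "F 1 1 = tri \<Psi> (\<lambda>x y z. tri \<Phi> (\<lambda>X Y Z. \<epsilon> (z * Z) *s F (x * X) (y * Y)))"
    by (subst \<Psi>\<Phi>[of "\<lambda>a b c. \<epsilon> c *s F a b"]) (intro lin_intros, simp add: eps_one)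
  also have "\<dots> = tri \<Psi> (\<lambda>x y z. tri \<Phi> (\<lambda>X Y Z. tri \<Phi> (\<lambda>p q r.
      \<epsilon> r *s (\<epsilon> (z * Z) *s F (x * (X * p)) (y * (Y * q))))))"
    by (subst *[of "\<lambda>a b c. \<epsilon> (_ * c) *s F (_ * a) (_ * b)"]) (intro lin_intros refl)+
  also have "\<dots> = tri \<Psi> (\<lambda>x y z. tri \<Phi> (\<lambda>X Y Z. tri \<Phi> (\<lambda>p q r.
      \<epsilon> r *s (\<epsilon> (z * Z) *s F (x * X * p) (y * Y * q)))))"
    by (simp add: mult.assoc)
  also have "\<dots> = tri \<Phi> (\<lambda>p q r. \<epsilon> r *s (\<epsilon> 1 *s F (1 * p) (1 * q)))"
    by (rule \<Psi>\<Phi>[where F="\<lambda>x y z. tri \<Phi> (\<lambda>p q r. \<epsilon> r *s (\<epsilon> z *s F (x * p) (y * q)))"])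
      (intro lin_intros)
  finally show ?thesis by (simp add: eps_one)
qed

text \<open>With \<epsilon> on the second leg of the pentagon the unknown factor stands to the left
  of \<phi>. Hence \<phi> has to be cancelled on the right, which is why \<open>G\<close> carries
  \<phi>^-1 there.\<close>

lemma eps_assoc_left:
  assumes F: "lin2 F"
  shows "tri \<Phi> (\<lambda>X Y Z. \<epsilon> X *s F Y Z) = F 1 1"
proof -
  note [lin_intros] = lin2D[OF F]
  have *: "tri \<Phi> G = tri \<Phi> (\<lambda>X Y Z. \<epsilon> X *s tri \<Phi> (\<lambda>p q r. G p (Y * q) (Z * r)))"
    if G: "lin3 G" for G
  proof -
    note [lin_intros] = lin3D[OF G]
    have "lin4 (\<lambda>a b c d. \<epsilon> b *s G a c d)" by (intro lin_intros)
    note pentagon[OF this]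
    also have "tri \<Phi> (\<lambda>X Y Z. D (\<lambda>Z1 Z2. tri \<Phi> (\<lambda>X' Y' Z'.
         D (\<lambda>X1 X2. \<epsilon> (Y * X2) *s G (X * X1) (Z1 * Y') (Z2 * Z')) X')) Z) =
       tri \<Phi> (\<lambda>X Y Z. \<epsilon> Y *s D (\<lambda>Z1 Z2. tri \<Phi> (\<lambda>X' Y' Z'.
         D (\<lambda>X1 X2. \<epsilon> X2 *s G (X * X1) (Z1 * Y') (Z2 * Z')) X')) Z)"
      by (simp add: eps_mult scale_D scale_tri)
    also have "\<dots> = D (\<lambda>Z1 Z2. tri \<Phi> (\<lambda>X' Y' Z'.
         D (\<lambda>X1 X2. \<epsilon> X2 *s G (1 * X1) (Z1 * Y') (Z2 * Z')) X')) 1"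
      by (rule eps_assoc) (intro lin_intros)
    also have "\<dots> = tri \<Phi> (\<lambda>X' Y' Z'. D (\<lambda>X1 X2. \<epsilon> X2 *s G (1 * X1) (1 * Y') (1 * Z')) X')"
      by (subst D_one) (intro lin_intros refl)+
    also have "\<dots> = tri \<Phi> G"
      by (subst counit_right_lin) (intro lin_intros, simp)
    also have "tri \<Phi> (\<lambda>X Y Z. tri \<Phi> (\<lambda>X' Y' Z'. D (\<lambda>Y1 Y2. tri \<Phi> (\<lambda>X'' Y'' Z''.
         \<epsilon> (X * Y1 * Y'') *s G (X' * X'') (Y * Y2 * Z'') (Z * Z'))) Y')) =
       tri \<Phi> (\<lambda>X Y Z. \<epsilon> X *s tri \<Phi> (\<lambda>X' Y' Z'. D (\<lambda>Y1 Y2. \<epsilon> Y1 *s tri \<Phi> (\<lambda>X'' Y'' Z''.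
         \<epsilon> Y'' *s G (X' * X'') (Y * Y2 * Z'') (Z * Z'))) Y'))"
      by (simp add: eps_mult scale_D scale_tri mult.assoc)
    also have "\<dots> = tri \<Phi> (\<lambda>X Y Z. \<epsilon> X *s tri \<Phi> (\<lambda>X' Y' Z'. D (\<lambda>Y1 Y2. \<epsilon> Y1 *s
         G (X' * 1) (Y * Y2 * 1) (Z * Z')) Y'))"
      by (subst eps_assoc) (intro lin_intros refl)+
    also have "\<dots> = tri \<Phi> (\<lambda>X Y Z. \<epsilon> X *s tri \<Phi> (\<lambda>X' Y' Z'. G (X' * 1) (Y * Y' * 1) (Z * Z')))"
      by (subst counit_left_lin) (intro lin_intros refl)+
    finally show ?thesis by simp
  qed
  define G where "G a b c = tri \<Psi> (\<lambda>x y z. \<epsilon> (a * x) *s F (b * y) (c * z))" for a b c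
  have G: "lin3 G" unfolding G_def by (intro lin_intros)
  have "F 1 1 = tri \<Phi> G"
    unfolding G_def by (subst \<Phi>\<Psi>[of "\<lambda>a b c. \<epsilon> a *s F b c"]) (intro lin_intros, simp add: eps_one)
  also have "\<dots> = tri \<Phi> (\<lambda>X Y Z. \<epsilon> X *s tri \<Phi> (\<lambda>p q r. G p (Y * q) (Z * r)))"
    by (rule *[OF G])
  also have "\<dots> = tri \<Phi> (\<lambda>X Y Z. \<epsilon> X *s tri \<Phi> (\<lambda>p q r. tri \<Psi> (\<lambda>x y z.
      \<epsilon> (p * x) *s F (Y * (q * y)) (Z * (r * z)))))"
    by (simp add: G_def mult.assoc)
  also have "\<dots> = tri \<Phi> (\<lambda>X Y Z. \<epsilon> X *s F Y Z)"
    by (subst \<Phi>\<Psi>[of "\<lambda>a b c. \<epsilon> a *s F (_ * b) (_ * c)"]) (intro lin_intros, simp add: eps_one)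
  finally show ?thesis by simp
qed

text \<open>Apply \<epsilon> to one leg of \<phi>^-1 \<phi> = 1. As \<epsilon> is multiplicative,
  the contribution of \<phi> splits off and is already known to be trivial.\<close>

lemma eps_assoc_inv:
  assumes F: "lin2 F"
  shows "tri \<Psi> (\<lambda>x y z. \<epsilon> x *s F y z) = F 1 1" "tri \<Psi> (\<lambda>x y z. \<epsilon> y *s F x z) = F 1 1"
    "tri \<Psi> (\<lambda>x y z. \<epsilon> z *s F x y) = F 1 1"
proof -
  note [lin_intros] = lin2D[OF F]
  have "F 1 1 = tri \<Psi> (\<lambda>x y z. tri \<Phi> (\<lambda>X Y Z. \<epsilon> (x * X) *s F (y * Y) (z * Z)))"
    by (subst \<Psi>\<Phi>[of "\<lambda>a b c. \<epsilon> a *s F b c"]) (intro lin_intros, simp add: eps_one)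
  also have "\<dots> = tri \<Psi> (\<lambda>x y z. \<epsilon> x *s tri \<Phi> (\<lambda>X Y Z. \<epsilon> X *s F (y * Y) (z * Z)))"
    by (simp add: eps_mult scale_tri)
  also have "\<dots> = tri \<Psi> (\<lambda>x y z. \<epsilon> x *s F y z)"
    by (subst eps_assoc_left) (intro lin_intros, simp)
  finally show "tri \<Psi> (\<lambda>x y z. \<epsilon> x *s F y z) = F 1 1" by simp
  have "F 1 1 = tri \<Psi> (\<lambda>x y z. tri \<Phi> (\<lambda>X Y Z. \<epsilon> (y * Y) *s F (x * X) (z * Z)))"
    by (subst \<Psi>\<Phi>[of "\<lambda>a b c. \<epsilon> b *s F a c"]) (intro lin_intros, simp add: eps_one)
  also have "\<dots> = tri \<Psi> (\<lambda>x y z. \<epsilon> y *s tri \<Phi> (\<lambda>X Y Z. \<epsilon> Y *s F (x * X) (z * Z)))"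
    by (simp add: eps_mult scale_tri)
  also have "\<dots> = tri \<Psi> (\<lambda>x y z. \<epsilon> y *s F x z)"
    by (subst eps_assoc) (intro lin_intros, simp)
  finally show "tri \<Psi> (\<lambda>x y z. \<epsilon> y *s F x z) = F 1 1" by simp
  have "F 1 1 = tri \<Psi> (\<lambda>x y z. tri \<Phi> (\<lambda>X Y Z. \<epsilon> (z * Z) *s F (x * X) (y * Y)))"
    by (subst \<Psi>\<Phi>[of "\<lambda>a b c. \<epsilon> c *s F a b"]) (intro lin_intros, simp add: eps_one)
  also have "\<dots> = tri \<Psi> (\<lambda>x y z. \<epsilon> z *s tri \<Phi> (\<lambda>X Y Z. \<epsilon> Z *s F (x * X) (y * Y)))"
    by (simp add: eps_mult scale_tri)
  also have "\<dots> = tri \<Psi> (\<lambda>x y z. \<epsilon> z *s F x y)"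
    by (subst eps_assoc_right) (intro lin_intros, simp)
  finally show "tri \<Psi> (\<lambda>x y z. \<epsilon> z *s F x y) = F 1 1" by simp
qed

lemma S_assoc_lin: "lin f \<Longrightarrow> tri \<Phi> (\<lambda>X Y Z. f (X * \<beta> * S Y * \<alpha> * Z)) = f 1"
  using tri_push[of f \<Phi> "\<lambda>X Y Z. X * \<beta> * S Y * \<alpha> * Z"] by (simp add: S_assoc)

lemma S_assoc_inv_lin: "lin f \<Longrightarrow> tri \<Psi> (\<lambda>x y z. f (S x * \<alpha> * y * \<beta> * S z)) = f 1"
  using tri_push[of f \<Psi> "\<lambda>x y z. S x * \<alpha> * y * \<beta> * S z"] by (simp add: S_assoc_inv)

text \<open>\<open>PQ_one\<close> and \<open>QP_one\<close> evaluate the two rearranged pentagons on a 4-linear map for which the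
  antipode axioms collapse the right-hand side.\<close>

lemma PQ_one:
  assumes F: "lin2 F"
  shows "tri \<Phi> (\<lambda>X Y Z. D (\<lambda>u v. tri \<Psi> (\<lambda>x y z.
    F (u * x) (v * y * \<beta> * S (Y * z) * \<alpha> * Z))) X) = F 1 1"
proof -
  note [lin_intros] = lin2D[OF F]
  have "lin4 (\<lambda>a b c d. F a (b * \<beta> * S c * \<alpha> * d))" by (intro lin_intros)
  from pentagon_inv1[OF this, unfolded op_defs m4_def]
  have "tri \<Phi> (\<lambda>X Y Z. D (\<lambda>u v. tri \<Psi> (\<lambda>x y z.
      F (u * x) (v * y * \<beta> * S (Y * z) * \<alpha> * Z))) X) =
    tri \<Psi> (\<lambda>x y z. D (\<lambda>z1 z2. tri \<Phi> (\<lambda>X Y Z. tri \<Phi> (\<lambda>X' Y' Z'. D (\<lambda>u v.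
      F (x * X') (y * X * u * \<beta> * S (z1 * Y * v) * \<alpha> * (z2 * Z * Z'))) Y'))) z)"
    by (simp add: mult.assoc)
  also have "\<dots> = tri \<Psi> (\<lambda>x y z. D (\<lambda>z1 z2. tri \<Phi> (\<lambda>X Y Z. tri \<Phi> (\<lambda>X' Y' Z'. D (\<lambda>u v.
      F (x * X') (y * X * (u * \<beta> * S v) * S Y * S z1 * \<alpha> * z2 * Z * Z')) Y'))) z)"
    by (simp add: S_mult mult.assoc)
  also have "\<dots> = tri \<Psi> (\<lambda>x y z. D (\<lambda>z1 z2. tri \<Phi> (\<lambda>X Y Z. tri \<Phi> (\<lambda>X' Y' Z'.
      \<epsilon> Y' *s F (x * X') (y * X * \<beta> * S Y * S z1 * \<alpha> * z2 * Z * Z')))) z)"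
    by (subst S_right_lin) (intro lin_intros refl)+
  also have "\<dots> = tri \<Psi> (\<lambda>x y z. D (\<lambda>z1 z2. tri \<Phi> (\<lambda>X Y Z.
      F (x * 1) (y * X * \<beta> * S Y * S z1 * \<alpha> * z2 * Z * 1))) z)"
    by (subst eps_assoc) (intro lin_intros refl)+
  also have "\<dots> = tri \<Psi> (\<lambda>x y z. tri \<Phi> (\<lambda>X Y Z. D (\<lambda>z1 z2.
      F x (y * X * \<beta> * S Y * (S z1 * \<alpha> * z2) * Z)) z))"
    by (simp add: tri_D_swap mult.assoc)
  also have "\<dots> = tri \<Psi> (\<lambda>x y z. tri \<Phi> (\<lambda>X Y Z. \<epsilon> z *s F x (y * X * \<beta> * S Y * \<alpha> * Z)))"
    by (subst S_left_lin) (intro lin_intros refl)+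
  also have "\<dots> = tri \<Psi> (\<lambda>x y z. \<epsilon> z *s tri \<Phi> (\<lambda>X Y Z. F x (y * (X * \<beta> * S Y * \<alpha> * Z))))"
    by (simp add: scale_tri mult.assoc)
  also have "\<dots> = tri \<Psi> (\<lambda>x y z. \<epsilon> z *s F x (y * 1))"
    by (subst S_assoc_lin) (intro lin_intros refl)+
  also have "\<dots> = F 1 1"
    by (subst eps_assoc_inv) (intro lin_intros, simp)
  finally show ?thesis .
qed

lemma QP_one:
  assumes F: "lin2 F"
  shows "tri \<Psi> (\<lambda>x y z. D (\<lambda>u v. tri \<Phi> (\<lambda>X Y Z.
    F (X * u) (S (Y * v) * \<alpha> * Z * y * \<beta> * S z))) x) = F 1 1"
proof -
  note [lin_intros] = lin2D[OF F]
  have "lin4 (\<lambda>a b c d. F a (S b * \<alpha> * c * \<beta> * S d))" by (intro lin_intros)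
  from pentagon_inv2[OF this, unfolded op_defs m4_def]
  have "tri \<Phi> (\<lambda>X Y Z. tri \<Psi> (\<lambda>x y z. D (\<lambda>u v.
      F (X * u) (S (Y * v) * \<alpha> * (Z * y) * \<beta> * S z)) x)) =
    tri \<Psi> (\<lambda>x y z. D (\<lambda>u v. tri \<Psi> (\<lambda>x' y' z'. tri \<Phi> (\<lambda>X Y Z. D (\<lambda>Z1 Z2.
      F (x * X) (S (u * x' * Y) * \<alpha> * (v * y' * Z1) * \<beta> * S (z * z' * Z2))) Z))) y)"
    by (simp add: mult.assoc)
  also have "\<dots> = tri \<Psi> (\<lambda>x y z. D (\<lambda>u v. tri \<Psi> (\<lambda>x' y' z'. tri \<Phi> (\<lambda>X Y Z. D (\<lambda>Z1 Z2.
      F (x * X) (S Y * S x' * S u * \<alpha> * v * y' * (Z1 * \<beta> * S Z2) * S z' * S z)) Z))) y)"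
    by (simp add: S_mult mult.assoc)
  also have "\<dots> = tri \<Psi> (\<lambda>x y z. D (\<lambda>u v. tri \<Psi> (\<lambda>x' y' z'. tri \<Phi> (\<lambda>X Y Z.
      \<epsilon> Z *s F (x * X) (S Y * S x' * S u * \<alpha> * v * y' * \<beta> * S z' * S z)))) y)"
    by (subst S_right_lin) (intro lin_intros refl)+
  also have "\<dots> = tri \<Psi> (\<lambda>x y z. D (\<lambda>u v. tri \<Psi> (\<lambda>x' y' z'.
      F (x * 1) (S 1 * S x' * S u * \<alpha> * v * y' * \<beta> * S z' * S z))) y)"
    by (subst eps_assoc_right) (intro lin_intros refl)+
  also have "\<dots> = tri \<Psi> (\<lambda>x y z. tri \<Psi> (\<lambda>x' y' z'. D (\<lambda>u v.
      F x (S x' * (S u * \<alpha> * v) * y' * \<beta> * S z' * S z)) y))"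
    by (simp add: tri_D_swap mult.assoc S_one)
  also have "\<dots> = tri \<Psi> (\<lambda>x y z. tri \<Psi> (\<lambda>x' y' z'.
      \<epsilon> y *s F x (S x' * \<alpha> * y' * \<beta> * S z' * S z)))"
    by (subst S_left_lin) (intro lin_intros refl)+
  also have "\<dots> = tri \<Psi> (\<lambda>x y z. \<epsilon> y *s F x (1 * S z))"
    unfolding scale_tri[symmetric] by (subst S_assoc_inv_lin) (intro lin_intros refl)+
  also have "\<dots> = F 1 1"
    by (subst eps_assoc_inv) (intro lin_intros, simp add: S_one)
  finally have "tri \<Phi> (\<lambda>X Y Z. tri \<Psi> (\<lambda>x y z. D (\<lambda>u v.
      F (X * u) (S (Y * v) * \<alpha> * (Z * y) * \<beta> * S z)) x)) = F 1 1" .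
  then show ?thesis by (subst (asm) tri_swap) (simp add: tri_D_swap mult.assoc)
qed

section \<open>Integrals and the Casimir element\<close>

definition left_int :: "'a \<Rightarrow> bool" where "left_int l \<longleftrightarrow> (\<forall>a. a * l = \<epsilon> a *s l)"
definition right_int :: "'a \<Rightarrow> bool" where "right_int l \<longleftrightarrow> (\<forall>a. l * a = \<epsilon> a *s l)"

text \<open>Applying \<open>S\<close> to the second leg of q \<Delta>(l) p turns the factor
  \<open>S\<^sup>-\<^sup>1(\<alpha> Z) Y\<close> into \<open>S Y * \<alpha> * Z\<close> at the end,
  so no inverse antipode remains. With trivial \<phi> and \<alpha> = \<beta> = 1 this is the
  classical \<open>l\<^sub>1 \<otimes> S(l\<^sub>2)\<close>.\<close>

definition casimir :: "'a \<Rightarrow> ('a \<Rightarrow> 'a \<Rightarrow> 'a) \<Rightarrow> 'a" where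
  "casimir l F = D (\<lambda>u v. tri \<Phi> (\<lambda>X Y Z. tri \<Psi> (\<lambda>x y z.
     F (X * u * x) (S (v * y * \<beta> * S z) * S Y * \<alpha> * Z)))) l"

lemma casimir_push: "lin h \<Longrightarrow> h (casimir l F) = casimir l (\<lambda>e f. h (F e f))"
  by (simp add: casimir_def D_push tri_push)

text \<open>\<open>Q_move\<close> trades \<open>a\<close> in front of q for \<Delta>(a1) behind q
  and \<open>a2\<close> at the far right. The left integral absorbs \<open>a1\<close> as
  \<open>\<epsilon> a1\<close>, and the counit turns \<open>a2\<close> back into
  \<open>a\<close>.\<close>

lemma casimir_move:
  assumes l: "left_int l" and F: "lin2 F"
  shows "casimir l (\<lambda>e f. F (a * e) f) = casimir l (\<lambda>e f. F e (f * a))"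
proof -
  note [lin_intros] = lin2D[OF F]
  have "casimir l (\<lambda>e f. F (a * e) f) = D (\<lambda>u v. tri \<Psi> (\<lambda>x y z. tri \<Phi> (\<lambda>X Y Z.
     F (a * X * u * x) (S (v * y * \<beta> * S z) * (S Y * \<alpha> * Z))))) l"
    unfolding casimir_def by (subst tri_swap) (simp add: mult.assoc)
  also have "\<dots> = D (\<lambda>u v. tri \<Psi> (\<lambda>x y z. D (\<lambda>a1 a2. D (\<lambda>p q. tri \<Phi> (\<lambda>X Y Z.
     F (X * p * u * x) (S (v * y * \<beta> * S z) * (S (Y * q) * \<alpha> * Z * a2)))) a1) a)) l"
    by (subst Q_move) (intro lin_intros refl)+
  also have "\<dots> = D (\<lambda>a1 a2. D (\<lambda>p q. D (\<lambda>u v. tri \<Phi> (\<lambda>X Y Z. tri \<Psi> (\<lambda>x y z.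
     F (X * (p * u) * x) (S ((q * v) * y * \<beta> * S z) * S Y * \<alpha> * Z * a2)))) l) a1) a"
    by (subst tri_swap) (simp only: tri_D_swap D_swap[of _ _ l] S_mult mult.assoc)
  also have "\<dots> = D (\<lambda>a1 a2. D (\<lambda>u v. tri \<Phi> (\<lambda>X Y Z. tri \<Psi> (\<lambda>x y z.
     F (X * u * x) (S (v * y * \<beta> * S z) * S Y * \<alpha> * Z * a2)))) (a1 * l)) a"
    by (subst D_mult) (intro lin_intros refl)+
  also have "\<dots> = D (\<lambda>a1 a2. \<epsilon> a1 *s D (\<lambda>u v. tri \<Phi> (\<lambda>X Y Z. tri \<Psi> (\<lambda>x y z.
     F (X * u * x) (S (v * y * \<beta> * S z) * S Y * \<alpha> * Z * a2)))) l) a"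
  proof -
    have "lin (D (\<lambda>u v. tri \<Phi> (\<lambda>X Y Z. tri \<Psi> (\<lambda>x y z.
     F (X * u * x) (S (v * y * \<beta> * S z) * S Y * \<alpha> * Z * a2)))))" for a2
      by (intro lin_intros)
    then show ?thesis using l by (simp add: left_int_def lin_iff)
  qed
  also have "\<dots> = casimir l (\<lambda>e f. F e (f * a))"
    unfolding casimir_def by (rule counit_left_lin) (intro lin_intros)
  finally show ?thesis .
qed

text \<open>\<open>P_move\<close> trades \<open>a\<close> behind p for \<Delta>(a1) in front of p,
  absorbed by the right integral, and \<open>a2\<close> inside \<open>S (a2 * z)\<close>. The outer
  \<open>S\<close> on the second leg then puts \<open>S (S a2)\<close> in front: this is the origin
  of the square of the antipode.\<close>

lemma casimir_twist:
  assumes l: "right_int l" and F: "lin2 F"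
  shows "casimir l (\<lambda>e f. F (e * a) f) = casimir l (\<lambda>e f. F e (S (S a) * f))"
proof -
  note [lin_intros] = lin2D[OF F]
  have "casimir l (\<lambda>e f. F (e * a) f) = D (\<lambda>u v. tri \<Phi> (\<lambda>X Y Z. tri \<Psi> (\<lambda>x y z.
     F (X * u * (x * a)) (S (v * (y * \<beta> * S z)) * S Y * \<alpha> * Z)))) l"
    unfolding casimir_def by (simp add: mult.assoc)
  also have "\<dots> = D (\<lambda>u v. tri \<Phi> (\<lambda>X Y Z. D (\<lambda>a1 a2. D (\<lambda>p q. tri \<Psi> (\<lambda>x y z.
     F (X * u * (p * x)) (S (v * (q * y * \<beta> * S (a2 * z))) * S Y * \<alpha> * Z))) a1) a)) l"
    by (subst P_move[of "\<lambda>r s. F (_ * _ * r) (S (_ * s) * S _ * \<alpha> * _)"]) (intro lin_intros refl)+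
  also have "\<dots> = D (\<lambda>a1 a2. D (\<lambda>u v. D (\<lambda>p q. tri \<Phi> (\<lambda>X Y Z. tri \<Psi> (\<lambda>x y z.
     F (X * (u * p) * x) (S (S a2) * (S ((v * q) * y * \<beta> * S z) * S Y * \<alpha> * Z))))) a1) l) a"
    by (simp only: tri_D_swap D_swap[of _ _ l] S_mult mult.assoc)
  also have "\<dots> = D (\<lambda>a1 a2. D (\<lambda>u v. tri \<Phi> (\<lambda>X Y Z. tri \<Psi> (\<lambda>x y z.
     F (X * u * x) (S (S a2) * (S (v * y * \<beta> * S z) * S Y * \<alpha> * Z))))) (l * a1)) a"
    by (subst D_mult) (intro lin_intros refl)+
  also have "\<dots> = D (\<lambda>a1 a2. \<epsilon> a1 *s D (\<lambda>u v. tri \<Phi> (\<lambda>X Y Z. tri \<Psi> (\<lambda>x y z.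
     F (X * u * x) (S (S a2) * (S (v * y * \<beta> * S z) * S Y * \<alpha> * Z))))) l) a"
  proof -
    have "lin (D (\<lambda>u v. tri \<Phi> (\<lambda>X Y Z. tri \<Psi> (\<lambda>x y z.
     F (X * u * x) (S (S a2) * (S (v * y * \<beta> * S z) * S Y * \<alpha> * Z))))))" for a2
      by (intro lin_intros)
    then show ?thesis using l by (simp add: right_int_def lin_iff)
  qed
  also have "\<dots> = casimir l (\<lambda>e f. F e (S (S a) * f))"
    unfolding casimir_def by (rule counit_left_lin) (intro lin_intros)
  finally show ?thesis .
qed

text \<open>Apply \<epsilon> to the left antipode axiom; since
  \<open>\<epsilon> \<alpha> = 1\<close>, the counit axiom finishes.\<close>

lemma eps_S: "\<epsilon> (S a) = \<epsilon> a"
proof -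
  have "\<epsilon> (\<epsilon> a *s \<alpha>) = D (\<lambda>u v. \<epsilon> (S u * \<alpha> * v)) a"
    unfolding S_left[symmetric] by (rule D_pushg[OF eps_linear])
  then have "\<epsilon> a = D (\<lambda>u v. \<epsilon> (S (\<epsilon> v *s u))) a"
    by (simp add: eps_scale eps_alpha eps_mult S_scale mult.commute)
  also have "\<dots> = \<epsilon> (S (D (\<lambda>u v. \<epsilon> v *s u) a))"
    by (rule D_pushg[symmetric]) (intro lin_intros)
  finally show ?thesis by (simp add: counit_right)
qed

lemma casimir_eps_right: "casimir l (\<lambda>e f. \<epsilon> f *s e) = l"
proof -
  have "casimir l (\<lambda>e f. \<epsilon> f *s e) = D (\<lambda>u v. tri \<Phi> (\<lambda>X Y Z. \<epsilon> Y *s tri \<Psi> (\<lambda>x y z.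
     \<epsilon> y *s (\<epsilon> (v * z * Z) *s (X * u * x))))) l"
    by (simp add: casimir_def eps_mult eps_S eps_alpha eps_beta scale_tri mult_ac)
  also have "\<dots> = D (\<lambda>u v. \<epsilon> (v * 1 * 1) *s (1 * u * 1)) l"
    apply (subst eps_assoc_inv) apply (intro lin_intros)
    apply (subst eps_assoc) apply (intro lin_intros)
    apply (rule refl)
    done
  also have "\<dots> = l" by (simp add: counit_right)
  finally show ?thesis .
qed

text \<open>The asymmetry with \<open>casimir_eps_right\<close> is due to \<alpha> and \<beta>:
  there they contribute only \<open>\<epsilon> \<alpha> = \<epsilon> \<beta> = 1\<close>, here they
  lie on the surviving leg.\<close>

lemma casimir_eps_left: "casimir l (\<lambda>e f. \<epsilon> e *s f) = S \<beta> * S l * \<alpha>"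
proof -
  have "casimir l (\<lambda>e f. \<epsilon> e *s f) = D (\<lambda>u v. \<epsilon> u *s tri \<Phi> (\<lambda>X Y Z. \<epsilon> X *s tri \<Psi> (\<lambda>x y z.
     \<epsilon> x *s (S (v * y * \<beta> * S z) * S Y * \<alpha> * Z)))) l"
    by (simp add: casimir_def eps_mult scale_tri mult_ac)
  also have "\<dots> = D (\<lambda>u v. \<epsilon> u *s (S (v * 1 * \<beta> * S 1) * S 1 * \<alpha> * 1)) l"
    apply (subst eps_assoc_inv) apply (intro lin_intros)
    apply (subst eps_assoc_left) apply (intro lin_intros)
    apply (rule refl)
    done
  also have "\<dots> = S \<beta> * S l * \<alpha>"
    by (subst counit_left_lin) (intro lin_intros, simp add: S_one S_mult)
  finally show ?thesis .
qed

text \<open>\<open>q \<Delta>(h)\<close> and \<open>\<Delta>(h) p\<close>, with \<open>S\<close> applied to the second leg of the former to avoid \<open>S\<^sup>-\<^sup>1\<close>.\<close>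

definition QD :: "'a \<Rightarrow> ('a \<Rightarrow> 'a \<Rightarrow> 'a) \<Rightarrow> 'a" where
  "QD h F = D (\<lambda>u v. tri \<Phi> (\<lambda>X Y Z. F (X * u) (S (Y * v) * \<alpha> * Z))) h"

definition DP :: "'a \<Rightarrow> ('a \<Rightarrow> 'a \<Rightarrow> 'a) \<Rightarrow> 'a" where
  "DP h F = D (\<lambda>u v. tri \<Psi> (\<lambda>x y z. F (u * x) (v * y * \<beta> * S z))) h"

lemma QD_push: "lin g \<Longrightarrow> g (QD h F) = QD h (\<lambda>e f. g (F e f))"
  and DP_push: "lin g \<Longrightarrow> g (DP h F) = DP h (\<lambda>e f. g (F e f))"
  by (simp_all add: QD_def DP_def D_push tri_push)

lemma QD_sum: "QD h (\<lambda>e f. \<Sum>i\<in>I. F i e f) = (\<Sum>i\<in>I. QD h (F i))"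
  and DP_sum: "DP h (\<lambda>e f. \<Sum>i\<in>I. F i e f) = (\<Sum>i\<in>I. DP h (F i))"
  unfolding QD_def DP_def D_def tri_sum_swap by (rule sum.swap)+

lemma
  assumes "lin2 F"
  shows QD_lin: "lin (\<lambda>h. QD h F)" and DP_lin: "lin (\<lambda>h. DP h F)"
  unfolding QD_def DP_def by (intro lin_intros lin2D[OF assms])+

text \<open>One composite of the two quasi-Hopf replacements for
  \<open>a \<otimes> b \<mapsto> a\<^sub>1 \<otimes> a\<^sub>2 b\<close> and its inverse, taken at
  \<open>h \<otimes> 1\<close>. \<open>Q_move\<close> pulls \<open>h\<close> out in front of q, and
  what remains is \<open>QP_one\<close>.\<close>

lemma DP_QD:
  assumes F: "lin2 F"
  shows "DP h (\<lambda>e f. QD e (\<lambda>e' f'. F e' (f' * f))) = F h 1"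
proof -
  note [lin_intros] = lin2D[OF F]
  have "DP h (\<lambda>e f. QD e (\<lambda>e' f'. F e' (f' * f))) = D (\<lambda>u v. tri \<Psi> (\<lambda>x y z.
     D (\<lambda>u1 u2. D (\<lambda>x1 x2. tri \<Phi> (\<lambda>X Y Z. F (X * (u1 * x1)) (S (Y * (u2 * x2)) * \<alpha> * Z * (v * y * \<beta> * S z)))) x) u)) h"
    unfolding QD_def DP_def by (subst D_mult) (intro lin_intros refl)+
  also have "\<dots> = tri \<Psi> (\<lambda>x y z. D (\<lambda>u v. D (\<lambda>u1 u2. D (\<lambda>x1 x2. tri \<Phi> (\<lambda>X Y Z.
     F (X * (u1 * x1)) (S (Y * (u2 * x2)) * \<alpha> * Z * (v * y * \<beta> * S z)))) x) u) h)"
    by (rule tri_D_swap[symmetric])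
  also have "\<dots> = tri \<Psi> (\<lambda>x y z. D (\<lambda>u v. D (\<lambda>x1 x2. D (\<lambda>u1 u2. tri \<Phi> (\<lambda>X Y Z.
     F (X * (u1 * x1)) (S (Y * (u2 * x2)) * \<alpha> * Z * (v * y * \<beta> * S z)))) u) x) h)"
    by (subst D_swap) (rule refl)
  also have "\<dots> = tri \<Psi> (\<lambda>x y z. D (\<lambda>x1 x2. D (\<lambda>u v. D (\<lambda>u1 u2. tri \<Phi> (\<lambda>X Y Z.
     F (X * (u1 * x1)) (S (Y * (u2 * x2)) * \<alpha> * Z * (v * y * \<beta> * S z)))) u) h) x)"
    by (subst D_swap) (rule refl)
  also have "\<dots> = tri \<Psi> (\<lambda>x y z. D (\<lambda>x1 x2. D (\<lambda>u v. D (\<lambda>u1 u2. tri \<Phi> (\<lambda>X Y Z.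
     F (X * u1 * x1) (S x2 * (S (Y * u2) * \<alpha> * Z * v) * (y * \<beta> * S z)))) u) h) x)"
    by (simp add: S_mult mult.assoc)
  also have "\<dots> = tri \<Psi> (\<lambda>x y z. D (\<lambda>x1 x2. tri \<Phi> (\<lambda>X Y Z.
     F (h * X * x1) (S x2 * (S Y * \<alpha> * Z) * (y * \<beta> * S z)))) x)"
    by (subst Q_move[of "\<lambda>r s. F (r * _) (S _ * s * _)"]) (intro lin_intros refl)+
  also have "\<dots> = tri \<Psi> (\<lambda>x y z. D (\<lambda>u v. tri \<Phi> (\<lambda>X Y Z.
      F (h * (X * u)) (S (Y * v) * \<alpha> * Z * y * \<beta> * S z))) x)"
    by (simp add: S_mult mult.assoc)
  also have "\<dots> = F (h * 1) 1"
    by (rule QP_one) (intro lin_intros)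
  finally show ?thesis by simp
qed

text \<open>The opposite composite: \<open>P_move\<close> pulls \<open>h\<close> out behind p, and
  what remains is \<open>PQ_one\<close>.\<close>

lemma QD_DP:
  assumes F: "lin2 F"
  shows "QD h (\<lambda>e f. DP e (\<lambda>e' f'. F e' (f' * f))) = F h 1"
proof -
  note [lin_intros] = lin2D[OF F]
  have "QD h (\<lambda>e f. DP e (\<lambda>e' f'. F e' (f' * f))) = D (\<lambda>u v. tri \<Phi> (\<lambda>X Y Z.
     D (\<lambda>X1 X2. D (\<lambda>u1 u2. tri \<Psi> (\<lambda>x y z. F (X1 * u1 * x) (X2 * u2 * y * \<beta> * S z * (S (Y * v) * \<alpha> * Z)))) u) X)) h"
    unfolding QD_def DP_def by (subst D_mult) (intro lin_intros refl)+
  also have "\<dots> = tri \<Phi> (\<lambda>X Y Z. D (\<lambda>X1 X2. D (\<lambda>u v. D (\<lambda>u1 u2. tri \<Psi> (\<lambda>x y z.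
     F (X1 * (u1 * x)) (X2 * (u2 * y * \<beta> * S (v * z)) * (S Y * \<alpha> * Z)))) u) h) X)"
    by (simp add: tri_D_swap[symmetric] D_swap[of _ _ h] S_mult mult.assoc)
  also have "\<dots> = tri \<Phi> (\<lambda>X Y Z. D (\<lambda>X1 X2. tri \<Psi> (\<lambda>x y z.
     F (X1 * (x * h)) (X2 * (y * \<beta> * S z) * (S Y * \<alpha> * Z)))) X)"
    by (subst P_move[of "\<lambda>r s. F (_ * r) (_ * s * _)"]) (intro lin_intros refl)+
  also have "\<dots> = tri \<Phi> (\<lambda>X Y Z. D (\<lambda>u v. tri \<Psi> (\<lambda>x y z.
    F (u * x * h) (v * y * \<beta> * S (Y * z) * \<alpha> * Z))) X)"
    by (simp add: S_mult mult.assoc)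
  also have "\<dots> = F (1 * h) 1"
    by (rule PQ_one) (intro lin_intros)
  finally show ?thesis by simp
qed

lemma QD_mult:
  assumes F: "lin2 F"
  shows "QD h (\<lambda>e f. F (a * e) f) = D (\<lambda>a1 a2. QD (a1 * h) (\<lambda>e f. F e (f * a2))) a"
proof -
  note [lin_intros] = lin2D[OF F]
  have "QD h (\<lambda>e f. F (a * e) f) = D (\<lambda>u v. tri \<Phi> (\<lambda>X Y Z. F (a * X * u) (S v * (S Y * \<alpha> * Z)))) h"
    by (simp add: QD_def S_mult mult.assoc)
  also have "\<dots> = D (\<lambda>u v. D (\<lambda>a1 a2. D (\<lambda>p q. tri \<Phi> (\<lambda>X Y Z.
      F (X * p * u) (S v * (S (Y * q) * \<alpha> * Z * a2)))) a1) a) h"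
    by (subst Q_move) (intro lin_intros refl)+
  also have "\<dots> = D (\<lambda>a1 a2. D (\<lambda>p q. D (\<lambda>u v. tri \<Phi> (\<lambda>X Y Z.
      F (X * (p * u)) (S (Y * (q * v)) * \<alpha> * Z * a2))) h) a1) a"
    by (simp add: D_swap[of _ _ h] S_mult mult.assoc)
  also have "\<dots> = D (\<lambda>a1 a2. QD (a1 * h) (\<lambda>e f. F e (f * a2))) a"
    unfolding QD_def by (subst D_mult) (intro lin_intros refl)+
  finally show ?thesis .
qed

section \<open>Existence of a nonzero left integral by a partial trace\<close>

lemma trace_cyclic:
  "(\<Sum>b\<in>Basis. QD (h * b) (\<lambda>e f. coord b (c * (S f * x)) *s e)) =
   (\<Sum>b\<in>Basis. QD (h * c * b) (\<lambda>e f. coord b (S f * x) *s e))"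
proof -
  \<comment> \<open>The sum over \<open>b\<close> is a partial trace with values in the first leg,
    and \<open>coord b (c * m)\<close> is the matrix of left multiplication by \<open>c\<close>.
    Exchanging the sums moves this matrix from the output to the input, as in tr(AB) =
    tr(BA).\<close>
  have ex: "coord b (c * w) = (\<Sum>m\<in>Basis. coord m w * coord b (c * m))" for b w
    by (rule coord_expandg[of "\<lambda>w. coord b (c * w)"]) (intro lin_intros ling_compI[OF coord_linear])
  have e1: "coord b (c * (S f * x)) *s e = (\<Sum>m\<in>Basis. coord b (c * m) *s (coord m (S f * x) *s e))" for b e f
    by (subst ex) (simp add: scale_sum_left mult.commute)
  have "(\<Sum>b\<in>Basis. QD (h * b) (\<lambda>e f. coord b (c * (S f * x)) *s e)) =
    (\<Sum>b\<in>Basis. \<Sum>m\<in>Basis. QD (h * b) (\<lambda>e f. coord b (c * m) *s (coord m (S f * x) *s e)))"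
    by (simp only: e1 QD_sum)
  also have "\<dots> = (\<Sum>b\<in>Basis. \<Sum>m\<in>Basis. coord b (c * m) *s QD (h * b) (\<lambda>e f. coord m (S f * x) *s e))"
    by (subst QD_push[symmetric]) (intro lin_intros refl)+
  also have "\<dots> = (\<Sum>m\<in>Basis. \<Sum>b\<in>Basis. coord b (c * m) *s QD (h * b) (\<lambda>e f. coord m (S f * x) *s e))"
    by (rule sum.swap)
  also have "\<dots> = (\<Sum>m\<in>Basis. QD (h * (c * m)) (\<lambda>e f. coord m (S f * x) *s e))"
  proof (rule sum.cong[OF refl])
    fix m
    have L: "lin (\<lambda>b. QD (h * b) (\<lambda>e f. coord m (S f * x) *s e))"
      by (intro lin_compI[OF QD_lin] lin_intros ling_compI[OF coord_linear])
    have "QD (h * (\<Sum>b\<in>Basis. coord b (c * m) *s b)) (\<lambda>e f. coord m (S f * x) *s e) =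
      (\<Sum>b\<in>Basis. QD (h * (coord b (c * m) *s b)) (\<lambda>e f. coord m (S f * x) *s e))"
      by (rule lin_sum[OF L])
    also have "\<dots> = (\<Sum>b\<in>Basis. coord b (c * m) *s QD (h * b) (\<lambda>e f. coord m (S f * x) *s e))"
      using L by (simp add: lin_iff)
    finally show "(\<Sum>b\<in>Basis. coord b (c * m) *s QD (h * b) (\<lambda>e f. coord m (S f * x) *s e)) =
        QD (h * (c * m)) (\<lambda>e f. coord m (S f * x) *s e)"
      by (simp add: coord_expand)
  qed
  finally show ?thesis by (simp add: mult.assoc)
qed

text \<open>In a Hopf algebra the element is the sum of
  \<open>coord b (S\<^sup>2(b\<^sub>2) x) b\<^sub>1\<close> over the basis. \<open>QD_mult\<close>
  turns a left factor \<open>a\<close> into \<open>a1\<close> at the input and \<open>S a2\<close>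
  at the output; cyclicity brings them together as \<open>a1 * \<beta> * S a2\<close>, which is why
  \<beta> sits at the input.\<close>

lemma left_integral_trace:
  "left_int (\<Sum>b\<in>Basis. QD (\<beta> * b) (\<lambda>e f. coord b (S f * x) *s e))" (is "left_int ?L")
  unfolding left_int_def
proof
  fix a
  have F: "lin2 (\<lambda>e f. coord b (S f * x) *s e)" for b
    by (intro lin_intros ling_compI[OF coord_linear])
  have "a * ?L = (\<Sum>b\<in>Basis. QD (\<beta> * b) (\<lambda>e f. coord b (S f * x) *s (a * e)))"
    unfolding sum_distrib_left by (subst QD_push[of "\<lambda>x. a * x"]) (intro lin_intros, simp add: scale_mult_right)
  also have "\<dots> = (\<Sum>b\<in>Basis. D (\<lambda>a1 a2. QD (a1 * (\<beta> * b)) (\<lambda>e f. coord b (S (f * a2) * x) *s e)) a)"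
    by (subst QD_mult[OF F]) (rule refl)
  also have "\<dots> = D (\<lambda>a1 a2. \<Sum>b\<in>Basis. QD (a1 * \<beta> * b) (\<lambda>e f. coord b (S a2 * (S f * x)) *s e)) a"
    unfolding D_def by (subst sum.swap) (simp add: S_mult mult.assoc)
  also have "\<dots> = D (\<lambda>a1 a2. \<Sum>b\<in>Basis. QD (a1 * \<beta> * S a2 * b) (\<lambda>e f. coord b (S f * x) *s e)) a"
    by (simp add: trace_cyclic)
  also have "\<dots> = \<epsilon> a *s ?L"
    by (rule S_right_lin[of "\<lambda>y. \<Sum>b\<in>Basis. QD (y * b) (\<lambda>e f. coord b (S f * x) *s e)"])
      (intro lin_sumI lin_compI[OF QD_lin[OF F]] lin_intros)
  finally show "a * ?L = \<epsilon> a *s ?L" .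
qed

text \<open>The traces cannot all vanish, because \<open>QD_DP\<close> rebuilds \<beta> from them
  and \<open>\<epsilon> \<beta> = 1\<close> excludes \<beta> = 0.\<close>

lemma left_integral_exists: "\<exists>l. left_int l \<and> l \<noteq> 0"
proof (rule ccontr)
  assume "\<not> ?thesis"
  then have L0: "(\<Sum>b\<in>Basis. QD (\<beta> * b) (\<lambda>e f. coord b (S f * x) *s e)) = 0" for x
    using left_integral_trace by blast
  have ex: "coord b (S f * w) = (\<Sum>m\<in>Basis. coord m w * coord b (S f * m))" for b f w
    by (rule coord_expandg[of "\<lambda>w. coord b (S f * w)"]) (intro lin_intros ling_compI[OF coord_linear])
  \<comment> \<open>\<open>S\<close> reverses the product, and a basis expansion between the two
    factors separates \<open>f\<close> from \<open>f'\<close>: the part with \<open>f\<close> will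
    sum up to the trace at \<open>x = m\<close>.\<close>
  have e1: "coord b (S (f' * f) * 1) *s e = (\<Sum>m\<in>Basis. coord b (S f * m) *s (coord m (S f') *s e))" for b e f f'
    by (simp only: S_mult mult_1_right, subst ex) (simp add: scale_sum_left mult.commute)
  have F: "lin2 (\<lambda>e f. coord b (S f * x) *s e)" for b x
    by (intro lin_intros ling_compI[OF coord_linear])
  have "\<beta> * 1 = (\<Sum>b\<in>Basis. coord b 1 *s (\<beta> * b))"
    by (subst coord_expand[of 1, symmetric]) (simp add: sum_distrib_left scale_mult_right)
  also have "\<dots> = (\<Sum>b\<in>Basis. QD (\<beta> * b) (\<lambda>e f. DP e (\<lambda>e' f'. coord b (S (f' * f) * 1) *s e')))"
    by (subst QD_DP[OF F]) (simp add: S_one)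
  also have "\<dots> = (\<Sum>b\<in>Basis. QD (\<beta> * b) (\<lambda>e f. DP e (\<lambda>e' f'. \<Sum>m\<in>Basis.
      coord b (S f * m) *s (coord m (S f') *s e'))))"
    by (simp only: e1)
  also have "\<dots> = (\<Sum>b\<in>Basis. QD (\<beta> * b) (\<lambda>e f. \<Sum>m\<in>Basis.
      coord b (S f * m) *s DP e (\<lambda>e' f'. coord m (S f' * 1) *s e')))"
    unfolding DP_sum by (subst DP_push[symmetric]) (intro lin_intros, simp)
  also have "\<dots> = (\<Sum>m\<in>Basis. \<Sum>b\<in>Basis. QD (\<beta> * b) (\<lambda>e f.
      DP (coord b (S f * m) *s e) (\<lambda>e' f'. coord m (S f' * 1) *s e')))"
  proof -
    have "coord b (S f * m) *s DP e (\<lambda>e' f'. coord m (S f' * 1) *s e') =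
        DP (coord b (S f * m) *s e) (\<lambda>e' f'. coord m (S f' * 1) *s e')" for b f m e
      by (rule lin_scale[OF DP_lin[OF F], symmetric])
    then show ?thesis unfolding QD_sum by (subst sum.swap) simp
  qed
  also have "\<dots> = (\<Sum>m\<in>Basis. DP (\<Sum>b\<in>Basis. QD (\<beta> * b) (\<lambda>e f. coord b (S f * m) *s e))
      (\<lambda>e' f'. coord m (S f' * 1) *s e'))"
    by (subst lin_sum[OF DP_lin[OF F]], subst QD_push[OF DP_lin[OF F]]) (rule refl)
  also have "\<dots> = 0"
    unfolding L0 by (intro sum.neutral ballI lin_zero[OF DP_lin[OF F]])
  finally have "\<epsilon> \<beta> = 0" using ling_zero[OF eps_linear] by simp
  then show False by (simp add: eps_beta)
qed

text \<open>\<open>DP_QD\<close> at \<open>l\<close> rebuilds \<open>g x *s l\<close> from the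
  values of the auxiliary map \<open>T\<close>, so with \<open>l \<noteq> 0\<close> it suffices that
  \<open>T = 0\<close>; and \<open>T\<close> can be recovered from the \<open>casimir\<close> value
  assumed to be zero.\<close>

lemma casimir_nondegenerate:
  assumes l: "left_int l" "l \<noteq> 0" and g: "ling g" and z: "casimir l (\<lambda>e f. g f *s e) = 0"
  shows "g x = 0"
proof -
  note [lin_intros] = ling_compI[OF g]
  define T where "T x = DP l (\<lambda>e f. g (S f * x) *s e)" for x
  have T: "lin T" unfolding T_def DP_def by (intro lin_intros)
  note [lin_intros] = lin_compI[OF T]
  have F: "lin2 (\<lambda>e f. g (S f * x) *s e)" for x by (intro lin_intros)
  txt \<open>\<open>T\<close> is an invariant of \<open>H \<otimes> H\<^sup>*\<close>; such an invariant is determined by its evaluation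
    \<open>X T(S(Y) \<alpha> Z)\<close>, which for this \<open>T\<close> is \<open>g(f) e\<close>.\<close>
  have inv: "D (\<lambda>u v. u * T (S v * x)) a = \<epsilon> a *s T x" for a x
  proof -
    have "D (\<lambda>u v. u * T (S v * x)) a = D (\<lambda>u v. D (\<lambda>u' v'. tri \<Psi> (\<lambda>x' y z.
        g (S (v * v' * y * \<beta> * S z) * x) *s (u * u' * x'))) l) a"
      by (simp add: T_def DP_def mult_D mult_tri scale_mult_right S_mult mult.assoc)
    also have "\<dots> = DP (a * l) (\<lambda>e f. g (S f * x) *s e)"
      unfolding DP_def by (rule D_mult[symmetric]) (intro lin_intros)
    also have "\<dots> = \<epsilon> a *s T x"
      using l DP_lin[OF F] by (simp add: left_int_def T_def lin_iff)
    finally show ?thesis .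
  qed
  \<comment> \<open>A right factor \<open>a\<close> inside \<open>T\<close> comes out as a left
    factor, so the evaluation vanishes with every such factor as soon as it vanishes without
    one.\<close>
  have T': "tri \<Phi> (\<lambda>X Y Z. X * T (S Y * \<alpha> * Z * a)) = a * tri \<Phi> (\<lambda>X Y Z. X * T (S Y * \<alpha> * Z))" for a
  proof -
    have "a * tri \<Phi> (\<lambda>X Y Z. X * T (S Y * \<alpha> * Z)) = tri \<Phi> (\<lambda>X Y Z. a * X * T (S Y * \<alpha> * Z))"
      by (simp add: mult_tri mult.assoc)
    also have "\<dots> = D (\<lambda>u v. D (\<lambda>u1 u2. tri \<Phi> (\<lambda>X Y Z. X * u1 * T (S (Y * u2) * \<alpha> * Z * v))) u) a"
      by (rule Q_move[symmetric]) (intro lin_intros)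
    also have "\<dots> = D (\<lambda>u v. tri \<Phi> (\<lambda>X Y Z. X * D (\<lambda>u1 u2. u1 * T (S u2 * (S Y * \<alpha> * Z * v))) u)) a"
      by (simp add: mult_D tri_D_swap S_mult mult.assoc)
    also have "\<dots> = D (\<lambda>u v. \<epsilon> u *s tri \<Phi> (\<lambda>X Y Z. X * T (S Y * \<alpha> * Z * v))) a"
      by (simp add: inv scale_tri scale_mult_right)
    also have "\<dots> = tri \<Phi> (\<lambda>X Y Z. X * T (S Y * \<alpha> * Z * a))"
      by (rule counit_left_lin) (intro lin_intros)
    finally show ?thesis by simp
  qed
  have "tri \<Phi> (\<lambda>X Y Z. X * T (S Y * \<alpha> * Z)) = casimir l (\<lambda>e f. g f *s e)"
    unfolding T_def DP_def casimir_def by (simp add: mult_D mult_tri scale_mult_right tri_D_swap mult.assoc)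
  with T' z have T'0: "tri \<Phi> (\<lambda>X Y Z. X * T (S Y * \<alpha> * Z * a)) = 0" for a
    by simp
  have T0: "T w = 0" for w
  proof -
    \<comment> \<open>\<open>QP_one\<close> expands the two units; the legs of \<Delta>(x) are then
      absorbed by \<open>inv\<close>, leaving evaluations covered by \<open>T'0\<close>.\<close>
    have "T w = 1 * T (1 * w)" by simp
    also have "\<dots> = tri \<Psi> (\<lambda>x y z. D (\<lambda>u v. tri \<Phi> (\<lambda>X Y Z.
        X * u * T (S (Y * v) * \<alpha> * Z * y * \<beta> * S z * w))) x)"
      by (rule QP_one[symmetric]) (intro lin_intros)
    also have "\<dots> = tri \<Psi> (\<lambda>x y z. tri \<Phi> (\<lambda>X Y Z.
        X * D (\<lambda>u v. u * T (S v * (S Y * \<alpha> * Z * (y * \<beta> * S z * w)))) x))"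
      by (simp add: mult_D tri_D_swap S_mult mult.assoc)
    also have "\<dots> = tri \<Psi> (\<lambda>x y z. \<epsilon> x *s tri \<Phi> (\<lambda>X Y Z. X * T (S Y * \<alpha> * Z * (y * \<beta> * S z * w))))"
      unfolding inv by (simp add: scale_tri scale_mult_right)
    also have "\<dots> = 0" by (simp add: T'0 tri_zero)
    finally show ?thesis .
  qed
  have ex: "g (S f * y) = (\<Sum>m\<in>Basis. coord m y * g (S f * m))" for f y
    by (rule coord_expandg[of "\<lambda>y. g (S f * y)"]) (intro lin_intros)
  have e1: "g (S (f' * f) * x) *s e = (\<Sum>m\<in>Basis. g (S f * m) *s (coord m (S f' * x) *s e))" for e f f'
    by (simp only: S_mult mult.assoc, subst ex) (simp add: scale_sum_left mult.commute)
  have F': "lin2 (\<lambda>e' f'. coord m (S f' * x) *s e')" for m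
    by (intro lin_intros ling_compI[OF coord_linear])
  have "g x *s l = DP l (\<lambda>e f. QD e (\<lambda>e' f'. g (S (f' * f) * x) *s e'))"
    by (subst DP_QD[OF F]) (simp add: S_one)
  also have "\<dots> = DP l (\<lambda>e f. \<Sum>m\<in>Basis. g (S f * m) *s QD e (\<lambda>e' f'. coord m (S f' * x) *s e'))"
  proof -
    have "QD e (\<lambda>e' f'. g (S (f' * f) * x) *s e') =
        (\<Sum>m\<in>Basis. QD e (\<lambda>e' f'. g (S f * m) *s (coord m (S f' * x) *s e')))" for e f
      by (simp only: e1 QD_sum)
    then show ?thesis by (simp add: QD_push[OF lin_scaleI(1)[OF lin_idI]])
  qed
  also have "\<dots> = (\<Sum>m\<in>Basis. DP l (\<lambda>e f. QD (g (S f * m) *s e) (\<lambda>e' f'. coord m (S f' * x) *s e')))"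
    using QD_lin[OF F'] by (simp add: DP_sum lin_iff)
  also have "\<dots> = (\<Sum>m\<in>Basis. QD (T m) (\<lambda>e' f'. coord m (S f' * x) *s e'))"
    unfolding T_def by (subst DP_push[OF QD_lin[OF F']]) (rule refl)
  also have "\<dots> = 0" using lin_zero[OF QD_lin[OF F']] by (simp add: T0)
  finally show ?thesis using l(2) by simp
qed

section \<open>The Frobenius structure and uniqueness of integrals\<close>

lemma casimir_diff: "casimir l F - casimir l G = casimir l (\<lambda>e f. F e f - G e f)"
proof -
  have t: "tri K F - tri K G = tri K (\<lambda>x y z. F x y z - G x y z)" for K and F G :: "'a \<Rightarrow> 'a \<Rightarrow> 'a \<Rightarrow> 'a"
    by (induction K) (auto simp: tri_def algebra_simps)
  show ?thesis by (simp add: casimir_def D_def t sum_subtractf[symmetric])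
qed

lemma casimir_dual:
  assumes "ling g" "ling h"
  shows "g (casimir l (\<lambda>e f. h f *s e)) = h (casimir l (\<lambda>e f. g e *s f))"
  using assms by (simp add: casimir_def D_pushg tri_pushg) (simp add: ling_iff mult.commute)

text \<open>The map \<open>g \<mapsto> g(e) f\<close> from the dual of \<open>H\<close> to
  \<open>H\<close> has transpose \<open>h \<mapsto> h(f) e\<close>, which is injective by
  \<open>casimir_nondegenerate\<close>. So the map is surjective, and by equality of dimensions
  injective.\<close>

lemma casimir_functional:
  assumes l: "left_int l" "l \<noteq> 0"
  shows casimir_surj: "\<exists>g. ling g \<and> casimir l (\<lambda>e f. g e *s f) = y"
    and casimir_inj: "ling g \<Longrightarrow> casimir l (\<lambda>e f. g e *s f) = 0 \<Longrightarrow> g x = 0"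
proof -
  \<comment> \<open>\<open>G\<close> identifies \<open>H\<close> with its dual through the basis, so
    that \<open>C\<close> is an endomorphism of \<open>H\<close>.\<close>
  define G where "G x e = (\<Sum>b\<in>Basis. coord b x * coord b e)" for x e
  have Gl: "ling (G x)" for x
    unfolding G_def by (simp add: ling_iff sum.distrib sum_distrib_left coord_linear[unfolded ling_iff] algebra_simps)
  have Gl': "ling (\<lambda>x. G x e)" for e
    unfolding G_def by (simp add: ling_iff sum.distrib sum_distrib_left coord_linear[unfolded ling_iff] algebra_simps)
  define C where "C x = casimir l (\<lambda>e f. G x e *s f)" for x
  have C: "lin C" unfolding C_def casimir_def by (intro lin_intros Gl')
  have cb: "coord b m = (if b = m then 1 else 0)" if "m \<in> Basis" for b m
    using representation_basis[OF independent_Basis that] by simp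
  have CG: "casimir l (\<lambda>e f. g e *s f) = C (\<Sum>b\<in>Basis. g b *s b)" if g: "ling g" for g
  proof -
    have "coord b (\<Sum>m\<in>Basis. g m *s m) = g b" if "b \<in> Basis" for b
    proof -
      have "coord b (\<Sum>m\<in>Basis. g m *s m) = (\<Sum>m\<in>Basis. if b = m then g m else 0)"
        unfolding ling_sum[OF coord_linear]
        by (rule sum.cong) (simp_all add: coord_linear[unfolded ling_iff] cb)
      then show ?thesis using that by (simp add: finite_Basis)
    qed
    then have "G (\<Sum>b\<in>Basis. g b *s b) e = g e" for e
      unfolding G_def coord_expandg[OF g, of e] by (intro sum.cong) simp_all
    then show ?thesis by (simp add: C_def)
  qed
  have surjC: "surj C"
  proof (rule functionals_vanish_imp_surj[OF C])
    fix h y assume h: "ling h" "\<And>x. h (C x) = 0"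
    have "casimir l (\<lambda>e f. h f *s e) = 0"
    proof (rule ling_eqI)
      fix g assume g: "ling g"
      then show "g (casimir l (\<lambda>e f. h f *s e)) = g 0"
        using casimir_dual[OF g h(1), of l] h(2) CG[OF g] by (simp add: ling_zero)
    qed
    then show "h y = 0" by (rule casimir_nondegenerate[OF l h(1)])
  qed
  from surjD[OF this] obtain w where "y = C w" by (rule exE)
  then show "\<exists>g. ling g \<and> casimir l (\<lambda>e f. g e *s f) = y"
    by (intro exI[of _ "G w"] conjI Gl) (simp add: C_def)
  assume g: "ling g" and z: "casimir l (\<lambda>e f. g e *s f) = 0"
  have "inj C" by (rule linear_surj_imp_inj[OF C surjC])
  with z have s0: "(\<Sum>b\<in>Basis. g b *s b) = 0"
    unfolding CG[OF g] using lin_zero[OF C] by (metis injD)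
  have "g b = 0" if "b \<in> Basis" for b
    using independentD[OF independent_Basis finite_Basis subset_refl s0 that] .
  then show "g x = 0" by (subst coord_expandg[OF g]) simp
qed

text \<open>\<open>\<kappa>\<close> is the preimage of 1 under \<open>g \<mapsto> g(e) f\<close>.
  \<open>casimir_move\<close> extends this to every \<open>b\<close>; the second identity is tested
  on functionals, each of which is a translate of \<open>\<kappa>\<close>.\<close>

lemma frobenius_functional:
  assumes l: "left_int l" "l \<noteq> 0"
  shows "\<exists>\<kappa>. ling \<kappa> \<and> (\<forall>b. casimir l (\<lambda>e f. \<kappa> (b * e) *s f) = b) \<and>
    (\<forall>b. casimir l (\<lambda>e f. \<kappa> (f * b) *s e) = b)"
proof -
  from casimir_surj[OF l, of 1] obtain \<kappa> where \<kappa>: "ling \<kappa>" and 1: "casimir l (\<lambda>e f. \<kappa> e *s f) = 1" by blast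
  note [lin_intros] = ling_compI[OF \<kappa>]
  have 2: "casimir l (\<lambda>e f. \<kappa> (b * e) *s f) = b" for b
  proof -
    have "casimir l (\<lambda>e f. \<kappa> (b * e) *s f) = casimir l (\<lambda>e f. \<kappa> e *s (f * b))"
      by (rule casimir_move[OF l(1)]) (intro lin_intros)
    also have "\<dots> = casimir l (\<lambda>e f. \<kappa> e *s f) * b"
      by (subst casimir_push[of "\<lambda>x. x * b"]) (intro lin_intros, simp add: scale_mult_left)
    finally show ?thesis by (simp add: 1)
  qed
  have 3: "casimir l (\<lambda>e f. \<kappa> (f * y) *s e) = y" for y
  proof (rule ling_eqI)
    fix g assume g: "ling g"
    \<comment> \<open>The candidate for \<open>g = \<kappa>(b \<cdot>)\<close>: both functionals
      have the image \<open>b\<close>, so injectivity identifies them.\<close>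
    define b where "b = casimir l (\<lambda>e f. g e *s f)"
    have "ling (\<lambda>e. \<kappa> (b * e) - g e)"
      using g \<kappa> by (simp add: ling_iff scale_mult_right algebra_simps)
    moreover have "casimir l (\<lambda>e f. (\<kappa> (b * e) - g e) *s f) = 0"
    proof -
      have "casimir l (\<lambda>e f. (\<kappa> (b * e) - g e) *s f) = b - casimir l (\<lambda>e f. g e *s f)"
        by (simp only: scale_left_diff_distrib casimir_diff[symmetric] 2)
      then show ?thesis by (simp add: b_def)
    qed
    ultimately have "\<kappa> (b * y) - g y = 0" by (rule casimir_inj[OF l])
    moreover have "g (casimir l (\<lambda>e f. \<kappa> (f * y) *s e)) = \<kappa> (b * y)"
    proof -
      have "ling (\<lambda>f. \<kappa> (f * y))" by (intro lin_intros)
      from casimir_dual[OF g this] show ?thesis by (simp add: b_def)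
    qed
    ultimately show "g (casimir l (\<lambda>e f. \<kappa> (f * y) *s e)) = g y" by simp
  qed
  show ?thesis by (intro exI[of _ \<kappa>] conjI allI \<kappa> 2 3)
qed

text \<open>Put an integral into the two reproducing identities of \<open>\<kappa>\<close>: it
  reduces a Casimir leg to its counit, and \<open>casimir_eps_right\<close> or
  \<open>casimir_eps_left\<close> evaluates the rest. That the same \<open>\<kappa>\<close> serves
  left and right integrals is what \<open>S_two_sided\<close> exploits.\<close>

lemma integral_multiple:
  assumes l: "left_int l" "l \<noteq> 0"
  shows "\<exists>\<kappa>. ling \<kappa> \<and> (\<forall>l'. left_int l' \<longrightarrow> l' = \<kappa> l' *s l) \<and>
    (\<forall>r. right_int r \<longrightarrow> r = \<kappa> r *s (S \<beta> * S l * \<alpha>))"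
proof -
  obtain \<kappa> where \<kappa>: "ling \<kappa>" "\<forall>b. casimir l (\<lambda>e f. \<kappa> (b * e) *s f) = b"
    "\<forall>b. casimir l (\<lambda>e f. \<kappa> (f * b) *s e) = b"
    using frobenius_functional[OF l] by (elim exE conjE) (rule that)
  have sc: "casimir l (\<lambda>e f. c *s F e f) = c *s casimir l F" for c F
    by (rule casimir_push[symmetric]) (intro lin_intros)
  have "l' = \<kappa> l' *s l" if "left_int l'" for l'
  proof -
    have "casimir l (\<lambda>e f. \<kappa> (f * l') *s e) = casimir l (\<lambda>e f. \<kappa> l' *s (\<epsilon> f *s e))"
      using that \<kappa>(1) by (simp add: left_int_def ling_iff mult.commute)
    then show ?thesis by (simp only: \<kappa>(3)[rule_format] sc casimir_eps_right)
  qed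
  moreover have "r = \<kappa> r *s (S \<beta> * S l * \<alpha>)" if "right_int r" for r
  proof -
    have "casimir l (\<lambda>e f. \<kappa> (r * e) *s f) = casimir l (\<lambda>e f. \<kappa> r *s (\<epsilon> e *s f))"
      using that \<kappa>(1) by (simp add: right_int_def ling_iff mult.commute)
    then show ?thesis by (simp only: \<kappa>(2)[rule_format] sc casimir_eps_left)
  qed
  ultimately show ?thesis by (intro exI[of _ \<kappa>] conjI allI impI \<kappa>(1))
qed

section \<open>The antipode on integrals and unimodularity\<close>

lemma right_int_scale: "right_int l \<Longrightarrow> right_int (c *s l)"
  by (simp add: right_int_def scale_mult_right scale_mult_left mult.commute)

lemma S_left_int: "left_int l \<Longrightarrow> right_int (S l)" and S_right_int: "right_int l \<Longrightarrow> left_int (S l)"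
proof -
  have "S l * a = \<epsilon> a *s S l" if "left_int l" for a
  proof -
    obtain a' where a': "a = S a'" using S_bij by (metis bij_pointE)
    have "S l * a = S (a' * l)" by (simp add: a' S_mult)
    then show ?thesis using that by (simp add: a' left_int_def S_scale eps_S)
  qed
  then show "left_int l \<Longrightarrow> right_int (S l)" by (simp add: right_int_def)
  have "a * S l = \<epsilon> a *s S l" if "right_int l" for a
  proof -
    obtain a' where a': "a = S a'" using S_bij by (metis bij_pointE)
    have "a * S l = S (l * a')" by (simp add: a' S_mult)
    then show ?thesis using that by (simp add: a' right_int_def S_scale eps_S)
  qed
  then show "right_int l \<Longrightarrow> left_int (S l)" by (simp add: left_int_def)
qed

lemma S_beta_alpha_two_sided:
  assumes "left_int l" "right_int l"
  shows "S \<beta> * S l * \<alpha> = S l"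
  using assms(2) S_left_int[OF assms(1)] by (simp add: S_mult[symmetric] right_int_def eps_alpha eps_beta)

text \<open>As a left and as a right integral \<open>l\<close> is expanded with the same coefficient
  \<open>\<kappa> l\<close>; the left expansion forces it to be 1, and the right one then reads
  \<open>l = S l\<close>.\<close>

lemma S_two_sided:
  assumes l: "left_int l" "right_int l"
  shows "S l = l"
proof (cases "l = 0")
  case True
  then show ?thesis using lin_zero[OF S_linear] by simp
next
  case False
  obtain \<kappa> where \<kappa>: "l = \<kappa> l *s l" "l = \<kappa> l *s (S \<beta> * S l * \<alpha>)"
    using integral_multiple[OF l(1) False] l by metis
  have "\<kappa> l = 1" using \<kappa>(1) False by (metis scale_one scale_right_imp_eq)
  then show ?thesis using \<kappa>(2) S_beta_alpha_two_sided[OF l] by simp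
qed

text \<open>The description operator is well defined: left integrals form a line spanned by some
  \<open>l \<noteq> 0\<close>, and cancelling \<open>l\<close> gives both multiplicativity and
  uniqueness of the character.\<close>

lemma modulus_eq_eps_iff:
  "(THE \<mu>. algebra_character \<mu> \<and> (\<forall>l a. left_int l \<longrightarrow> l * a = \<mu> a *s l)) = \<epsilon> \<longleftrightarrow> (\<forall>l. left_int l \<longrightarrow> right_int l)"
proof -
  obtain l where l: "left_int l" "l \<noteq> 0" using left_integral_exists by blast
  obtain \<kappa> where \<kappa>: "ling \<kappa>" "\<And>l'. left_int l' \<Longrightarrow> l' = \<kappa> l' *s l"
    using integral_multiple[OF l] by blast
  \<comment> \<open>\<open>l * a\<close> is again a left integral, and \<open>\<kappa>\<close> reads
    off its coefficient with respect to \<open>l\<close>.\<close>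
  define \<mu> where "\<mu> a = \<kappa> (l * a)" for a
  have cancel: "c = d" if "c *s l = d *s l" for c d
    using that l(2) by (rule scale_right_imp_eq[rotated])
  have la: "l * a = \<mu> a *s l" for a
    unfolding \<mu>_def using l(1) by (intro \<kappa>(2)) (simp add: left_int_def mult.assoc[symmetric] scale_mult_left)
  have la': "l' * a = \<mu> a *s l'" if "left_int l'" for l' a
    using \<kappa>(2)[OF that] la[of a] by (metis scale_left_commute scale_mult_left)
  have "algebra_character \<mu>"
    unfolding algebra_character_def
  proof (intro conjI allI)
    show "ling \<mu>" unfolding \<mu>_def by (intro ling_compI[OF \<kappa>(1)] lin_intros)
    show "\<mu> 1 = 1" using la[of 1] by (intro cancel) simp
    fix a b
    have "\<mu> (a * b) *s l = l * a * b" by (simp add: la[symmetric] mult.assoc)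
    also have "\<dots> = (\<mu> a * \<mu> b) *s l" by (simp add: la scale_mult_left)
    finally show "\<mu> (a * b) = \<mu> a * \<mu> b" by (rule cancel)
  qed
  then have "(THE \<mu>. algebra_character \<mu> \<and> (\<forall>l a. left_int l \<longrightarrow> l * a = \<mu> a *s l)) = \<mu>"
  proof (intro the_equality conjI allI impI)
    fix \<nu> assume \<nu>: "algebra_character \<nu> \<and> (\<forall>l a. left_int l \<longrightarrow> l * a = \<nu> a *s l)"
    show "\<nu> = \<mu>"
    proof
      fix a
      show "\<nu> a = \<mu> a" using \<nu> l(1) la[of a] by (intro cancel) metis
    qed
  qed (use la' in auto)
  moreover have "\<mu> = \<epsilon> \<longleftrightarrow> (\<forall>l. left_int l \<longrightarrow> right_int l)"
  proof
    assume "\<mu> = \<epsilon>"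
    then show "\<forall>l. left_int l \<longrightarrow> right_int l" using la' by (simp add: right_int_def)
  next
    assume "\<forall>l. left_int l \<longrightarrow> right_int l"
    then have "\<epsilon> a *s l = \<mu> a *s l" for a using l(1) la by (metis right_int_def)
    then show "\<mu> = \<epsilon>" by (intro ext cancel) (rule sym)
  qed
  ultimately show ?thesis by simp
qed

text \<open>\<open>S\<close> exchanges left and right integrals, so an \<open>S\<close>-invariant
  one is two-sided; a single nonzero two-sided integral suffices because all left integrals are its
  multiples. Nonzero witnesses on both sides are \<open>l\<close> and \<open>S l\<close>.\<close>

lemma two_sided_iff_S_invariant:
  defines "U \<equiv> \<forall>l. left_int l \<longrightarrow> right_int l"
  shows "U \<longleftrightarrow> (\<exists>l. left_int l \<and> l \<noteq> 0 \<and> S l = l)" (is "U \<longleftrightarrow> ?el")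
    and "U \<longleftrightarrow> (\<forall>l. left_int l \<and> l \<noteq> 0 \<longrightarrow> S l = l)" (is "U \<longleftrightarrow> ?al")
    and "U \<longleftrightarrow> (\<exists>l. right_int l \<and> l \<noteq> 0 \<and> S l = l)" (is "U \<longleftrightarrow> ?er")
    and "U \<longleftrightarrow> (\<forall>l. right_int l \<and> l \<noteq> 0 \<longrightarrow> S l = l)" (is "U \<longleftrightarrow> ?ar")
proof -
  obtain l where l: "left_int l" "l \<noteq> 0" using left_integral_exists by blast
  have "S l \<noteq> S 0" using l(2) S_bij by (metis bij_pointE)
  then have Sl: "right_int (S l)" "S l \<noteq> 0" using S_left_int[OF l(1)] lin_zero[OF S_linear] by auto
  have two: U if "left_int m" "right_int m" "m \<noteq> 0" for m
    unfolding U_def using integral_multiple[OF that(1,3)] right_int_scale[OF that(2)] by metis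
  have el: "?el \<Longrightarrow> U" using two S_left_int by metis
  have er: "?er \<Longrightarrow> U" using two S_right_int by metis
  have al: "U \<Longrightarrow> ?al" unfolding U_def using S_two_sided by blast
  have ar: ?ar if U
  proof (intro allI impI)
    fix r assume r: "right_int r \<and> r \<noteq> 0"
    have "right_int l" using l(1) that U_def by blast
    then have "S \<beta> * S l * \<alpha> = l"
      using S_two_sided[OF l(1)] S_beta_alpha_two_sided[OF l(1)] by simp
    then obtain c where "r = c *s l" using integral_multiple[OF l] r by metis
    then show "S r = r" using S_two_sided l(1) \<open>right_int l\<close> by (simp add: S_scale)
  qed
  show "U \<longleftrightarrow> ?el" "U \<longleftrightarrow> ?al" "U \<longleftrightarrow> ?er" "U \<longleftrightarrow> ?ar"
    using el er al ar l Sl by blast+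
qed

section \<open>Traces and the Nakayama automorphism\<close>

lemma trace_imp_two_sided:
  assumes "nondegenerate_trace \<tau>" and l: "left_int l"
  shows "right_int l"
  unfolding right_int_def
proof
  fix b
  from assms(1) have \<tau>: "ling \<tau>" and sym: "\<And>a b. \<tau> (a * b) = \<tau> (b * a)"
    and nd: "\<And>a. (\<And>b. \<tau> (a * b) = 0) \<Longrightarrow> a = 0"
    by (auto simp: nondegenerate_trace_def)
  have tl: "\<tau> (a * l) = \<epsilon> a * \<tau> l" for a using l \<tau> by (simp add: left_int_def ling_iff)
  have td: "\<tau> (x - y) = \<tau> x - \<tau> y" for x y
    using \<tau> by (metis ling_iff add_diff_cancel diff_add_cancel)
  have "l * b - \<epsilon> b *s l = 0"
  proof (rule nd)
    fix c
    \<comment> \<open>The trace property moves \<open>l\<close> to the right end, where it converts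
      what precedes it into its counit; both terms become
      \<open>\<epsilon> b * \<epsilon> c * \<tau> l\<close>.\<close>
    have "\<tau> ((l * b - \<epsilon> b *s l) * c) = \<tau> (b * c * l) - \<epsilon> b * \<tau> (c * l)"
      using \<tau> by (simp add: left_diff_distrib td scale_mult_left mult.assoc sym[of l] ling_iff)
    then show "\<tau> ((l * b - \<epsilon> b *s l) * c) = 0" by (simp add: tl eps_mult)
  qed
  then show "l * b = \<epsilon> b *s l" by simp
qed

text \<open>The bijection \<open>\<theta>\<close> turns translates of functionals into products:
  \<open>g(b \<cdot>)\<close> goes to \<open>\<theta> g * b\<close> and, for two-sided
  \<open>l\<close>, \<open>g(\<cdot> b)\<close> goes to \<open>S (S b) * \<theta> g\<close>. Hence
  \<tau> is a trace iff \<open>t = \<theta> \<tau>\<close> satisfies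
  \<open>t * b = S (S b) * t\<close>, and nondegeneracy corresponds to \<open>t\<close> being a
  unit.\<close>

lemma symmetric_iff:
  "symmetric_algebra \<longleftrightarrow> (\<forall>l. left_int l \<longrightarrow> right_int l) \<and> inner_automorphism (S \<circ> S)"
proof -
  obtain l where l: "left_int l" "l \<noteq> 0" using left_integral_exists by blast
  define \<theta> where "\<theta> g = casimir l (\<lambda>e f. g e *s f)" for g
  have \<theta>_left: "\<theta> (\<lambda>e. g (b * e)) = \<theta> g * b" if g: "ling g" for g b
  proof -
    have "\<theta> (\<lambda>e. g (b * e)) = casimir l (\<lambda>e f. g e *s (f * b))"
      unfolding \<theta>_def by (rule casimir_move[OF l(1)]) (intro lin_intros ling_compI[OF g])
    also have "\<dots> = \<theta> g * b"
      unfolding \<theta>_def by (subst casimir_push[of "\<lambda>x. x * b"]) (intro lin_intros, simp add: scale_mult_left)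
    finally show ?thesis .
  qed
  have \<theta>_right: "\<theta> (\<lambda>e. g (e * b)) = S (S b) * \<theta> g" if g: "ling g" and "right_int l" for g b
  proof -
    have "\<theta> (\<lambda>e. g (e * b)) = casimir l (\<lambda>e f. g e *s (S (S b) * f))"
      unfolding \<theta>_def by (rule casimir_twist[OF \<open>right_int l\<close>]) (intro lin_intros ling_compI[OF g])
    also have "\<dots> = S (S b) * \<theta> g"
      unfolding \<theta>_def by (subst casimir_push[of "\<lambda>x. S (S b) * x"]) (intro lin_intros, simp add: scale_mult_right)
    finally show ?thesis .
  qed
  have \<theta>_inj: "g x = 0" if "ling g" "\<theta> g = 0" for g x
    using casimir_inj[OF l that(1)] that(2) by (simp add: \<theta>_def)
  show ?thesis
  proof
    assume symmetric_algebra
    then obtain \<tau> where tr: "nondegenerate_trace \<tau>" by (auto simp: symmetric_algebra_def)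
    then have \<tau>: "ling \<tau>" and sym: "\<And>a b. \<tau> (a * b) = \<tau> (b * a)"
      and nd: "\<And>a. (\<And>b. \<tau> (a * b) = 0) \<Longrightarrow> a = 0"
      by (auto simp: nondegenerate_trace_def)
    have two: "\<forall>l. left_int l \<longrightarrow> right_int l" using trace_imp_two_sided[OF tr] by blast
    define t where "t = \<theta> \<tau>"
    have "\<theta> (\<lambda>e. \<tau> (b * e)) = \<theta> (\<lambda>e. \<tau> (e * b))" for b by (simp add: sym[of b])
    then have tb: "t * b = S (S b) * t" for b
      using \<theta>_left[OF \<tau>] \<theta>_right[OF \<tau>] two l(1) by (simp add: t_def)
    have "b = 0" if "t * b = 0" for b
    proof (rule nd)
      fix c
      have "ling (\<lambda>e. \<tau> (b * e))" by (intro ling_compI[OF \<tau>] lin_intros)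
      then show "\<tau> (b * c) = 0"
        by (rule \<theta>_inj) (use \<theta>_left[OF \<tau>] that t_def in simp)
    qed
    then obtain t' where t': "t * t' = 1" "t' * t = 1" by (rule left_mult_inj_imp_unit) blast
    have "(S \<circ> S) a = t * a * t'" for a
      by (simp only: o_apply tb) (simp add: mult.assoc t')
    with t' have "inner_automorphism (S \<circ> S)" unfolding inner_automorphism_def by blast
    with two show "(\<forall>l. left_int l \<longrightarrow> right_int l) \<and> inner_automorphism (S \<circ> S)" by blast
  next
    assume A: "(\<forall>l. left_int l \<longrightarrow> right_int l) \<and> inner_automorphism (S \<circ> S)"
    then have r: "right_int l" using l(1) by blast
    from A obtain g g' where g: "g * g' = 1" "g' * g = 1" and SS: "\<And>a. S (S a) = g * a * g'"
      by (auto simp: inner_automorphism_def)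
    \<comment> \<open>The trace is the functional whose image under \<open>\<theta>\<close> is the
      unit implementing the inner automorphism.\<close>
    obtain \<tau> where \<tau>: "ling \<tau>" "\<theta> \<tau> = g"
      using casimir_surj[OF l] unfolding \<theta>_def by blast
    have sym: "\<tau> (b * e) = \<tau> (e * b)" for b e
    proof -
      have "\<theta> (\<lambda>e. \<tau> (b * e)) = \<theta> (\<lambda>e. \<tau> (e * b))"
        using \<theta>_left[OF \<tau>(1)] \<theta>_right[OF \<tau>(1) r] by (simp add: \<tau>(2) SS mult.assoc g)
      then have "\<theta> (\<lambda>e. \<tau> (b * e) - \<tau> (e * b)) = 0"
        by (simp add: \<theta>_def casimir_diff[symmetric] scale_left_diff_distrib)
      moreover have "ling (\<lambda>e. \<tau> (b * e) - \<tau> (e * b))"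
        using \<tau>(1) by (simp add: ling_iff algebra_simps scale_mult_left scale_mult_right)
      ultimately have "\<tau> (b * e) - \<tau> (e * b) = 0" by (intro \<theta>_inj)
      then show ?thesis by simp
    qed
    have nd: "a = 0" if "\<And>b. \<tau> (a * b) = 0" for a
    proof -
      have "g * a = \<theta> (\<lambda>e. \<tau> (a * e))" using \<theta>_left[OF \<tau>(1)] by (simp add: \<tau>(2))
      also have "\<dots> = 0" by (simp add: that \<theta>_def casimir_def tri_zero D_def)
      finally have "g' * (g * a) = 0" by simp
      then show "a = 0" by (simp add: mult.assoc[symmetric] g)
    qed
    have "nondegenerate_trace \<tau>"
      unfolding nondegenerate_trace_def
    proof (intro conjI allI impI)
      fix b assume b: "\<forall>a. \<tau> (a * b) = 0"
      have "\<tau> (b * c) = 0" for c using b sym[of b c] by simp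
      then show "b = 0" by (rule nd)
    qed (fact \<tau>(1), fact sym, rule nd, blast)
    then show symmetric_algebra by (auto simp: symmetric_algebra_def)
  qed
qed

end

section \<open>Evaluating tensors\<close>

context unital_algebra
begin

lemma tensor_add: "s \<in> tensor_power n \<Longrightarrow> t \<in> tensor_power n \<Longrightarrow> s + t \<in> tensor_power n"
  and tensor_zero: "0 \<in> tensor_power n"
  and tensor_scale: "t \<in> tensor_power n \<Longrightarrow> tscale c t \<in> tensor_power n"
  and tensor_pure: "length xs = n \<Longrightarrow> pure xs \<in> tensor_power n"
proof -
  interpret T: vector_space "tscale :: 'k \<Rightarrow> ('a, 'k) tensor \<Rightarrow> _" by (rule vector_space_tscale)
  show "s \<in> tensor_power n \<Longrightarrow> t \<in> tensor_power n \<Longrightarrow> s + t \<in> tensor_power n"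
    and "0 \<in> tensor_power n" and "t \<in> tensor_power n \<Longrightarrow> tscale c t \<in> tensor_power n"
    and "length xs = n \<Longrightarrow> pure xs \<in> tensor_power n"
    unfolding tensor_power_def by (auto intro: T.span_add T.span_zero T.span_scale T.span_base)
qed

lemma tensor_sum: "(\<And>i. i \<in> I \<Longrightarrow> t i \<in> tensor_power n) \<Longrightarrow> (\<Sum>i\<in>I. t i) \<in> tensor_power n"
  by (induction I rule: infinite_finite_induct) (simp_all add: tensor_add tensor_zero del: plus_fun_apply plus_fun_def)

lemma tensor_tri: "(\<And>x y z. T x y z \<in> tensor_power n) \<Longrightarrow> tri K T \<in> tensor_power n"
  unfolding tri_nth by (intro tensor_sum)

lemma tlift_zero:
  assumes "vector_space sW" "multilinear sW n F"
  shows "tlift n sW F 0 = 0"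
  using tlift_sum[OF assms, of "{}" "\<lambda>_. 0"] by simp

lemma tlift_sum_tensors:
  assumes F: "vector_space sW" "multilinear sW n F" and t: "\<And>i. i \<in> I \<Longrightarrow> t i \<in> tensor_power n"
  shows "tlift n sW F (\<Sum>i\<in>I. t i) = (\<Sum>i\<in>I. tlift n sW F (t i))"
  using t
proof (induction I rule: infinite_finite_induct)
  case (insert i I)
  then have "tlift n sW F (t i + (\<Sum>i\<in>I. t i)) = tlift n sW F (t i) + tlift n sW F (\<Sum>i\<in>I. t i)"
    by (intro tlift_add[OF F] tensor_sum) auto
  with insert show ?case by (simp only: sum.insert insert_iff simp_thms)
qed (use tlift_zero[OF F] in simp_all)

lemma tlift_tri:
  assumes "vector_space sW" "multilinear sW n F" "\<And>x y z. T x y z \<in> tensor_power n"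
  shows "tlift n sW F (tri K T) = tri K (\<lambda>x y z. tlift n sW F (T x y z))"
  unfolding tri_nth by (rule tlift_sum_tensors[OF assms(1,2)]) (rule assms(3))

abbreviation linT :: "('a \<Rightarrow> ('a, 'k) tensor) \<Rightarrow> bool" where
  "linT \<equiv> Vector_Spaces.linear scale tscale"

lemma linT_iff: "linT f \<longleftrightarrow> (\<forall>x y. f (x + y) = f x + f y) \<and> (\<forall>c x. f (scale c x) = tscale c (f x))"
  using vector_space_axioms vector_space_tscale
  by (auto simp: Vector_Spaces.linear_def module_hom_def module_hom_axioms_def module_iff_vector_space)

lemma linT_sum: "(\<And>i. i \<in> I \<Longrightarrow> linT (\<lambda>x. T x i)) \<Longrightarrow> linT (\<lambda>x. \<Sum>i\<in>I. T x i)"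
proof -
  interpret T: vector_space "tscale :: 'k \<Rightarrow> ('a, 'k) tensor \<Rightarrow> _" by (rule vector_space_tscale)
  assume "\<And>i. i \<in> I \<Longrightarrow> linT (\<lambda>x. T x i)"
  then show ?thesis
    by (simp add: linT_iff sum.distrib T.scale_sum_right del: plus_fun_apply plus_fun_def)
qed

lemma linT_scale: "linT T \<Longrightarrow> linT (\<lambda>x. tscale c (T x))"
proof -
  interpret T: vector_space "tscale :: 'k \<Rightarrow> ('a, 'k) tensor \<Rightarrow> _" by (rule vector_space_tscale)
  show "linT T \<Longrightarrow> linT (\<lambda>x. tscale c (T x))"
    by (simp add: linT_iff T.scale_right_distrib T.scale_left_commute mult.commute del: plus_fun_apply plus_fun_def)
qed

lemma linT_pure: "i < length xs \<Longrightarrow> linT (\<lambda>x. pure (xs[i := x]))"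
  using pure_multilinear unfolding multilinear_def by blast

lemma linT_pure3:
  "linT (\<lambda>x. pure [x, b, c])" "linT (\<lambda>x. pure [a, x, c])" "linT (\<lambda>x. pure [a, b, x])"
  using linT_pure[of 0 "[a, b, c]"] linT_pure[of 1 "[a, b, c]"] linT_pure[of 2 "[a, b, c]"] by simp_all

lemma linT_pure4:
  "linT (\<lambda>x. pure [x, b, c, d])" "linT (\<lambda>x. pure [a, x, c, d])" "linT (\<lambda>x. pure [a, b, x, d])"
  "linT (\<lambda>x. pure [a, b, c, x])"
  using linT_pure[of 0 "[a, b, c, d]"] linT_pure[of 1 "[a, b, c, d]"] linT_pure[of 2 "[a, b, c, d]"]
    linT_pure[of 3 "[a, b, c, d]"] by simp_all

lemma linT_pure2: "linT (\<lambda>x. pure [x, b])" "linT (\<lambda>x. pure [a, x])"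
  using linT_pure[of 0 "[a, b]"] linT_pure[of 1 "[a, b]"] by simp_all

lemma multilinear_pure_map2:
  "length xs = n \<Longrightarrow> multilinear tscale n (\<lambda>ys. pure (map2 (*) xs ys))"
  "length ys = n \<Longrightarrow> multilinear tscale n (\<lambda>xs. pure (map2 (*) xs ys))"
  unfolding multilinear_def
  using Vector_Spaces.linear_compose[OF linear_mult_left linT_pure, unfolded o_def]
    Vector_Spaces.linear_compose[OF linear_mult_right linT_pure, unfolded o_def]
  by (simp_all add: map2_update_left map2_update_right)

lemma multilinear_pure_append:
  "multilinear tscale n (\<lambda>ys. pure (xs @ ys))" "multilinear tscale n (\<lambda>xs. pure (xs @ ys))"
proof -
  show "multilinear tscale n (\<lambda>ys. pure (xs @ ys))"
    unfolding multilinear_def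
  proof (intro allI impI)
    fix ys :: "'a list" and i assume "length ys = n \<and> i < n"
    then show "linT (\<lambda>y. pure (xs @ ys[i := y]))"
      using linT_pure[of "length xs + i" "xs @ ys"] by (simp add: list_update_append)
  qed
  show "multilinear tscale n (\<lambda>xs. pure (xs @ ys))"
    unfolding multilinear_def
  proof (intro allI impI)
    fix xs :: "'a list" and i assume "length xs = n \<and> i < n"
    then show "linT (\<lambda>x. pure (xs[i := x] @ ys))"
      using linT_pure[of i "xs @ ys"] by (simp add: list_update_append)
  qed
qed

text \<open>\<open>tmult\<close> and \<open>tcat\<close> are nested lifts, so the inner lift must be
  multilinear in the outer list. Writing \<open>t\<close> once as a sum of pure tensors makes it a
  finite sum of multilinear maps.\<close>

lemma multilinear_tlift:
  fixes G :: "'a list \<Rightarrow> 'a list \<Rightarrow> ('a, 'k) tensor"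
  assumes R: "\<And>xs. length xs = m \<Longrightarrow> multilinear tscale n (G xs)"
    and L: "\<And>ys. length ys = n \<Longrightarrow> multilinear tscale m (\<lambda>xs. G xs ys)"
    and t: "t \<in> tensor_power n"
  shows "multilinear tscale m (\<lambda>xs. tlift n tscale (G xs) t)"
proof -
  from t obtain A c where A: "finite A" "\<forall>ys\<in>A. length ys = n"
    and t_eq: "t = (\<Sum>ys\<in>A. tscale (c ys) (pure ys))"
    unfolding tensor_power_explicit by blast
  have "tlift n tscale (G xs) t = (\<Sum>ys\<in>A. tscale (c ys) (G xs ys))" if "length xs = m" for xs
    unfolding t_eq using A by (intro tlift_sum vector_space_tscale R that) auto
  moreover have "multilinear tscale m (\<lambda>xs. \<Sum>ys\<in>A. tscale (c ys) (G xs ys))"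
    unfolding multilinear_def
  proof (intro allI impI linT_sum linT_scale)
    fix xs :: "'a list" and i ys assume "length xs = m \<and> i < m" "ys \<in> A"
    then show "linT (\<lambda>x. G (xs[i := x]) ys)" using L A(2) unfolding multilinear_def by blast
  qed
  ultimately show ?thesis by (simp cong: multilinear_cong)
qed

lemma tmult_multilinear:
  "t \<in> tensor_power n \<Longrightarrow> multilinear tscale n (\<lambda>xs. tlift n tscale (\<lambda>ys. pure (map2 (*) xs ys)) t)"
  by (rule multilinear_tlift) (auto intro: multilinear_pure_map2)

lemma tcat_multilinear:
  "t \<in> tensor_power n \<Longrightarrow> multilinear tscale m (\<lambda>xs. tlift n tscale (\<lambda>ys. pure (xs @ ys)) t)"
  by (rule multilinear_tlift) (auto intro: multilinear_pure_append)

lemma tmult_pure_left: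
  "length xs = n \<Longrightarrow> t \<in> tensor_power n \<Longrightarrow>
    tmult n (pure xs) t = tlift n tscale (\<lambda>ys. pure (map2 (*) xs ys)) t"
  unfolding tmult_def by (rule tlift_pure[OF vector_space_tscale tmult_multilinear])

lemma tcat_pure_left:
  "length xs = m \<Longrightarrow> t \<in> tensor_power n \<Longrightarrow>
    tcat m n (pure xs) t = tlift n tscale (\<lambda>ys. pure (xs @ ys)) t"
  unfolding tcat_def by (rule tlift_pure[OF vector_space_tscale tcat_multilinear])

lemma tmult_sum_left:
  "(\<And>i. s i \<in> tensor_power n) \<Longrightarrow> t \<in> tensor_power n \<Longrightarrow>
    tmult n (\<Sum>i\<in>I. s i) t = (\<Sum>i\<in>I. tmult n (s i) t)"
  unfolding tmult_def by (rule tlift_sum_tensors[OF vector_space_tscale tmult_multilinear])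

lemma tmult_sum_right:
  "length xs = n \<Longrightarrow> (\<And>i. t i \<in> tensor_power n) \<Longrightarrow>
    tmult n (pure xs) (\<Sum>i\<in>I. t i) = (\<Sum>i\<in>I. tmult n (pure xs) (t i))"
  by (simp add: tmult_pure_left tensor_sum tlift_sum_tensors[OF vector_space_tscale multilinear_pure_map2(1)])

lemma tcat_sum_left:
  "(\<And>i. s i \<in> tensor_power m) \<Longrightarrow> t \<in> tensor_power n \<Longrightarrow>
    tcat m n (\<Sum>i\<in>I. s i) t = (\<Sum>i\<in>I. tcat m n (s i) t)"
  unfolding tcat_def by (rule tlift_sum_tensors[OF vector_space_tscale tcat_multilinear])

lemma tcat_sum_right:
  "length xs = m \<Longrightarrow> (\<And>i. t i \<in> tensor_power n) \<Longrightarrow>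
    tcat m n (pure xs) (\<Sum>i\<in>I. t i) = (\<Sum>i\<in>I. tcat m n (pure xs) (t i))"
  by (simp add: tcat_pure_left tensor_sum tlift_sum_tensors[OF vector_space_tscale multilinear_pure_append(1)])

lemma tmult_tri_left:
  "(\<And>x y z. s x y z \<in> tensor_power n) \<Longrightarrow> t \<in> tensor_power n \<Longrightarrow>
    tmult n (tri K s) t = tri K (\<lambda>x y z. tmult n (s x y z) t)"
  unfolding tri_nth by (rule tmult_sum_left)

lemma tmult_tri_right:
  "length xs = n \<Longrightarrow> (\<And>x y z. t x y z \<in> tensor_power n) \<Longrightarrow>
    tmult n (pure xs) (tri K t) = tri K (\<lambda>x y z. tmult n (pure xs) (t x y z))"
  unfolding tri_nth by (rule tmult_sum_right)

lemma tcat_tri_left: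
  "(\<And>x y z. s x y z \<in> tensor_power m) \<Longrightarrow> t \<in> tensor_power n \<Longrightarrow>
    tcat m n (tri K s) t = tri K (\<lambda>x y z. tcat m n (s x y z) t)"
  unfolding tri_nth by (rule tcat_sum_left)

lemma tcat_tri_right:
  "length xs = m \<Longrightarrow> (\<And>x y z. t x y z \<in> tensor_power n) \<Longrightarrow>
    tcat m n (pure xs) (tri K t) = tri K (\<lambda>x y z. tcat m n (pure xs) (t x y z))"
  unfolding tri_nth by (rule tcat_sum_right)

text \<open>The scalar coefficients of a sum of pure tensors move into the first entry.\<close>

lemma tensor3_tri:
  assumes "t \<in> tensor_power 3"
  obtains K where "t = tri K (\<lambda>x y z. pure [x, y, z])"
proof -
  from assms obtain A c where A: "finite A" "\<forall>xs\<in>A. length xs = 3"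
    and t: "t = (\<Sum>xs\<in>A. tscale (c xs) (pure xs))"
    unfolding tensor_power_explicit by blast
  from A(1) obtain as where as: "set as = A" "distinct as" using finite_distinct_list by blast
  have "pure [scale (c xs) (xs ! 0), xs ! 1, xs ! 2] = tscale (c xs) (pure xs)" if "xs \<in> A" for xs
  proof -
    have "length xs = 3" using A(2) that by blast
    then have xs: "xs = [xs ! 0, xs ! 1, xs ! 2]"
      by (auto simp: numeral_3_eq_3 length_Suc_conv)
    have "pure [scale (c xs) (xs ! 0), xs ! 1, xs ! 2] = tscale (c xs) (pure [xs ! 0, xs ! 1, xs ! 2])"
      using linT_pure3(1) unfolding linT_iff by blast
    then show ?thesis using xs by simp
  qed
  then have "t = (\<Sum>xs\<leftarrow>as. pure [scale (c xs) (xs ! 0), xs ! 1, xs ! 2])"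
    unfolding t as(1)[symmetric] sum_list_distinct_conv_sum_set[OF as(2)] by (intro sum.cong) auto
  also have "\<dots> = tri (map (\<lambda>xs. (scale (c xs) (xs ! 0), xs ! 1, xs ! 2)) as) (\<lambda>x y z. pure [x, y, z])"
    by (simp add: tri_def o_def)
  finally show ?thesis by (rule that)
qed

lemma tone_simps: "tone 1 = pure [1]" "tone 2 = pure [1, 1]" "tone 3 = pure [1, 1, 1]"
  by (simp_all add: tone_def numeral_2_eq_2 numeral_3_eq_3)

lemma tmult3_assoc:
  assumes "s \<in> tensor_power 3" "t \<in> tensor_power 3" "u \<in> tensor_power 3"
  shows "tmult 3 (tmult 3 s t) u = tmult 3 s (tmult 3 t u)"
proof -
  from assms obtain K L M where "s = tri K (\<lambda>x y z. pure [x, y, z])" "t = tri L (\<lambda>x y z. pure [x, y, z])"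
    "u = tri M (\<lambda>x y z. pure [x, y, z])" by (metis tensor3_tri)
  then show ?thesis
    by (simp add: tmult_tri_left tmult_tri_right tmult_pure tensor_tri tensor_pure mult.assoc)
qed

lemma tmult3_one:
  assumes "t \<in> tensor_power 3"
  shows "tmult 3 t (tone 3) = t" "tmult 3 (tone 3) t = t"
proof -
  from assms obtain K where "t = tri K (\<lambda>x y z. pure [x, y, z])" by (rule tensor3_tri)
  then show "tmult 3 t (tone 3) = t" "tmult 3 (tone 3) t = t"
    by (simp_all add: tmult_tri_left tmult_tri_right tmult_pure tensor_tri tensor_pure tone_simps)
qed

text \<open>Associativity and the unit law in the third tensor power give uniqueness of inverses, on
  which the description operator depends.\<close>

lemma tinverse3:
  assumes "t \<in> tensor_power 3" and "\<exists>u\<in>tensor_power 3. tmult 3 t u = tone 3 \<and> tmult 3 u t = tone 3"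
  shows "tinverse 3 t \<in> tensor_power 3" "tmult 3 t (tinverse 3 t) = tone 3"
    "tmult 3 (tinverse 3 t) t = tone 3"
proof -
  have "\<exists>!u. u \<in> tensor_power 3 \<and> tmult 3 t u = tone 3 \<and> tmult 3 u t = tone 3"
    using assms tmult3_assoc tmult3_one by metis
  from theI'[OF this] show "tinverse 3 t \<in> tensor_power 3" "tmult 3 t (tinverse 3 t) = tone 3"
    "tmult 3 (tinverse 3 t) t = tone 3" unfolding tinverse_def by auto
qed

lemma multilinear2I:
  assumes "\<And>b. Vector_Spaces.linear scale sW (\<lambda>x. F x b)" "\<And>a. Vector_Spaces.linear scale sW (\<lambda>x. F a x)"
  shows "multilinear sW 2 (\<lambda>xs. F (xs ! 0) (xs ! 1))"
  unfolding multilinear_def using assms by (auto simp: less_Suc_eq numeral_eq_Suc)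

lemma multilinear3I:
  assumes "\<And>b c. Vector_Spaces.linear scale sW (\<lambda>x. F x b c)" "\<And>a c. Vector_Spaces.linear scale sW (\<lambda>x. F a x c)"
    "\<And>a b. Vector_Spaces.linear scale sW (\<lambda>x. F a b x)"
  shows "multilinear sW 3 (\<lambda>xs. F (xs ! 0) (xs ! 1) (xs ! 2))"
  unfolding multilinear_def using assms by (auto simp: less_Suc_eq numeral_eq_Suc)

lemma multilinear4I:
  assumes "\<And>b c d. Vector_Spaces.linear scale sW (\<lambda>x. F x b c d)" "\<And>a c d. Vector_Spaces.linear scale sW (\<lambda>x. F a x c d)"
    "\<And>a b d. Vector_Spaces.linear scale sW (\<lambda>x. F a b x d)" "\<And>a b c. Vector_Spaces.linear scale sW (\<lambda>x. F a b c x)"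
  shows "multilinear sW 4 (\<lambda>xs. F (xs ! 0) (xs ! 1) (xs ! 2) (xs ! 3))"
  unfolding multilinear_def using assms by (auto simp: less_Suc_eq numeral_eq_Suc)

end

text \<open>Otherwise the index \<open>1\<close> in \<open>tlift2\<close> and \<open>tlift3\<close> is rewritten to \<open>Suc 0\<close> in goals but not in
  rewrite rules.\<close>

declare One_nat_def [simp del]

context sweedler_algebra
begin

lemma tensor_D: "(\<And>u v. T u v \<in> tensor_power n) \<Longrightarrow> D T a \<in> tensor_power n"
  unfolding D_def by (rule tensor_sum)

lemma tlift_D:
  assumes "vector_space sW" "multilinear sW n F" "\<And>u v. T u v \<in> tensor_power n"
  shows "tlift n sW F (D T a) = D (\<lambda>u v. tlift n sW F (T u v)) a"
  unfolding D_def by (rule tlift_sum_tensors[OF assms(1,2)]) (rule assms(3))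

lemma tmult_D_left:
  "(\<And>u v. s u v \<in> tensor_power n) \<Longrightarrow> t \<in> tensor_power n \<Longrightarrow>
    tmult n (D s a) t = D (\<lambda>u v. tmult n (s u v) t) a"
  unfolding D_def by (rule tmult_sum_left)

lemma tmult_D_right:
  "length xs = n \<Longrightarrow> (\<And>u v. t u v \<in> tensor_power n) \<Longrightarrow>
    tmult n (pure xs) (D t a) = D (\<lambda>u v. tmult n (pure xs) (t u v)) a"
  unfolding D_def by (rule tmult_sum_right)

lemma tcat_D_left:
  "(\<And>u v. s u v \<in> tensor_power m) \<Longrightarrow> t \<in> tensor_power n \<Longrightarrow>
    tcat m n (D s a) t = D (\<lambda>u v. tcat m n (s u v) t) a"
  unfolding D_def by (rule tcat_sum_left)

lemma tcat_D_right:
  "length xs = m \<Longrightarrow> (\<And>u v. t u v \<in> tensor_power n) \<Longrightarrow>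
    tcat m n (pure xs) (D t a) = D (\<lambda>u v. tcat m n (pure xs) (t u v)) a"
  unfolding D_def by (rule tcat_sum_right)

lemma linT_D_fun: "(\<And>u v. linT (\<lambda>x. T x u v)) \<Longrightarrow> linT (\<lambda>x. D (\<lambda>u v. T x u v) a)"
  unfolding D_def by (rule linT_sum)

lemma linT_D_arg: "(\<And>u. linT (T u)) \<Longrightarrow> linT (\<lambda>x. D T x)"
  unfolding D_def
proof (rule linT_sum)
  fix b assume "\<And>u. linT (T u)"
  then show "linT (\<lambda>x. T b (R b x))"
    using R_linear[of b] by (simp add: lin_iff linT_iff)
qed

lemma linT_scale_functional: "ling g \<Longrightarrow> linT (\<lambda>x. tscale (g x) t)"
proof -
  interpret T: vector_space "tscale :: 'k \<Rightarrow> ('a, 'k) tensor \<Rightarrow> _" by (rule vector_space_tscale)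
  show "ling g \<Longrightarrow> linT (\<lambda>x. tscale (g x) t)"
    by (simp add: linT_iff ling_iff T.scale_left_distrib del: plus_fun_apply plus_fun_def)
qed

lemmas tensor_simps = tensor_D tensor_tri tensor_pure tmult_D_left tmult_D_right tmult_tri_left
  tmult_tri_right tcat_D_left tcat_D_right tcat_tri_left tcat_tri_right tmult_pure tcat_pure tone_simps

lemmas linT_intros = linT_D_fun linT_D_arg linT_pure2 linT_pure3 linT_pure4

lemma lin2_multilinear: "lin2 F \<Longrightarrow> multilinear scale 2 (\<lambda>xs. F (xs ! 0) (xs ! 1))"
  by (rule multilinear2I) (auto simp: lin2_def)

lemma lin3_multilinear: "lin3 F \<Longrightarrow> multilinear scale 3 (\<lambda>xs. F (xs ! 0) (xs ! 1) (xs ! 2))"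
  by (rule multilinear3I) (auto simp: lin3_def)

lemma lin4_multilinear: "lin4 F \<Longrightarrow> multilinear scale 4 (\<lambda>xs. F (xs ! 0) (xs ! 1) (xs ! 2) (xs ! 3))"
  by (rule multilinear4I) (auto simp: lin4_def)

end

section \<open>From the axioms to coordinates\<close>

context quasi_bialgebra
begin

text \<open>\<open>R b\<close> is \<Delta> followed by the coordinate functional of \<open>b\<close>
  on the first leg, hence linear in \<open>a\<close>. Choosing a sum of pure tensors for each
  \<open>\<Delta> a\<close> separately would not give this linearity.\<close>

lemma comult_coordinates:
  assumes "finite_dimensional_vector_space scale Basis"
  obtains R where "sweedler_algebra scale Basis R"
    "\<And>a. \<Delta> a = (\<Sum>b\<in>Basis. pure [b, R b a])"
proof -
  interpret B: finite_dimensional_vector_space scale Basis by fact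
  let ?coord = "\<lambda>b x. representation Basis x b"
  let ?scale = "\<lambda>b x y. scale (?coord b x) y"
  define R where "R b a = tlift2 scale (?scale b) (\<Delta> a)" for b a
  have ml: "multilinear scale 2 (\<lambda>xs. ?scale b (xs ! 0) (xs ! 1))" for b
    by (rule multilinear2I)
      (use vector_space_axioms in \<open>simp_all add: Vector_Spaces.linear_def module_hom_def module_hom_axioms_def
        module_iff_vector_space representation_add representation_scale B.independent_Basis
        B.span_Basis algebra_simps\<close>)
  have "Vector_Spaces.linear scale scale (R b)" for b
    using comult_linear comult_in
    by (simp add: R_def linT_iff tlift_add[OF vector_space_axioms ml] tlift_scale[OF vector_space_axioms ml]
        Vector_Spaces.linear_def module_hom_def module_hom_axioms_def module_iff_vector_space vector_space_axioms)
  then have sw: "sweedler_algebra scale Basis R"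
    by (intro sweedler_algebra.intro sweedler_algebra_axioms.intro unital_algebra_axioms assms)
  have pure_eq: "(\<Sum>b\<in>Basis. pure [b, ?scale b x y]) = pure [x, y]" for x y
  proof -
    interpret X: Vector_Spaces.linear scale tscale "\<lambda>x. pure [x, y]" by (rule linT_pure2)
    have "pure [b, ?scale b x y] = pure [scale (?coord b x) b, y]" for b
      using linT_pure2(2)[of b] X.scale by (simp add: linT_iff)
    then have "(\<Sum>b\<in>Basis. pure [b, ?scale b x y]) = pure [\<Sum>b\<in>Basis. scale (?coord b x) b, y]"
      by (simp add: X.sum)
    also have "(\<Sum>b\<in>Basis. scale (?coord b x) b) = x"
      by (rule sum_representation_eq) (simp_all add: B.independent_Basis B.span_Basis B.finite_Basis)
    finally show ?thesis .
  qed
  have expand: "t = (\<Sum>b\<in>Basis. pure [b, tlift2 scale (?scale b) t])" if t: "t \<in> tensor_power 2" for t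
  proof -
    interpret T: vector_space "tscale :: 'k \<Rightarrow> ('a, 'k) tensor \<Rightarrow> _" by (rule vector_space_tscale)
    have p: "linT (\<lambda>x. pure [b, x])" for b by (rule linT_pure2)
    \<comment> \<open>The identity and the claimed expansion are linear and agree on pure tensors,
      so both equal the lift of \<open>pure\<close>.\<close>
    have "t = tlift 2 tscale pure t"
      by (rule tlift_unique[OF vector_space_tscale pure_multilinear, of 2 "\<lambda>t. t"]) (use t in auto)
    moreover have "(\<Sum>b\<in>Basis. pure [b, tlift2 scale (?scale b) t]) = tlift 2 tscale pure t"
    proof (rule tlift_unique[OF vector_space_tscale pure_multilinear _ _ _ t])
      fix xs :: "'a list" assume xs: "length xs = 2"
      then have "xs = [xs ! 0, xs ! 1]" by (auto simp: numeral_2_eq_2 length_Suc_conv)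
      then show "(\<Sum>b\<in>Basis. pure [b, tlift2 scale (?scale b) (pure xs)]) = pure xs"
        using pure_eq[of "xs ! 0" "xs ! 1"] by (simp add: tlift_pure[OF vector_space_axioms ml xs])
    next
      fix s t assume "s \<in> tensor_power 2" "t \<in> tensor_power 2"
      then show "(\<Sum>b\<in>Basis. pure [b, tlift2 scale (?scale b) (s + t)]) =
        (\<Sum>b\<in>Basis. pure [b, tlift2 scale (?scale b) s]) + (\<Sum>b\<in>Basis. pure [b, tlift2 scale (?scale b) t])"
        using p by (simp add: tlift_add[OF vector_space_axioms ml] linT_iff sum.distrib
            del: plus_fun_apply plus_fun_def)
    next
      fix a t assume "t \<in> tensor_power 2"
      then show "(\<Sum>b\<in>Basis. pure [b, tlift2 scale (?scale b) (tscale a t)]) =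
        tscale a (\<Sum>b\<in>Basis. pure [b, tlift2 scale (?scale b) t])"
        using p by (simp add: tlift_scale[OF vector_space_axioms ml] linT_iff T.scale_sum_right)
    qed
    ultimately show ?thesis by simp
  qed
  have "\<Delta> a = (\<Sum>b\<in>Basis. pure [b, R b a])" for a
    unfolding R_def by (rule expand[OF comult_in])
  with sw show ?thesis by (rule that)
qed

end

context quasi_hopf_algebra
begin

text \<open>Each tensor axiom is evaluated by the lift of an arbitrary multilinear \<open>F\<close>.
  A lift can be computed on pure tensors only after its integrand is known to be multilinear, so
  this is established for every map that inserts \<Delta> into a leg.\<close>

lemma sweedler_quasi_hopf:
  assumes finite_dimensional
  shows "\<exists>Basis R \<Phi> \<Psi>. sweedler_quasi_hopf scale Basis R \<epsilon> \<Phi> \<Psi> S \<alpha> \<beta>"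
proof -
  from assms obtain Basis where Basis: "finite_dimensional_vector_space scale Basis"
    by (auto simp: finite_dimensional_def)
  obtain R where R: "sweedler_algebra scale Basis R" and \<Delta>R: "\<And>a. \<Delta> a = (\<Sum>b\<in>Basis. pure [b, R b a])"
    using comult_coordinates[OF Basis] by blast
  interpret sweedler_algebra scale Basis R by fact
  have \<Delta>: "\<Delta> = (\<lambda>a. D (\<lambda>u v. pure [u, v]) a)" by (rule ext) (simp add: \<Delta>R D_def)
  obtain \<Phi> where \<Phi>: "\<phi> = tri \<Phi> (\<lambda>x y z. pure [x, y, z])" using assoc_in by (rule tensor3_tri)
  note inv = tinverse3[OF assoc_in assoc_invertible]
  obtain \<Psi> where \<Psi>: "tinverse 3 \<phi> = tri \<Psi> (\<lambda>x y z. pure [x, y, z])" using inv(1) by (rule tensor3_tri)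
  have eps: "ling \<epsilon>" "\<epsilon> 1 = 1" "\<And>a b. \<epsilon> (a * b) = \<epsilon> a * \<epsilon> b"
    using counit by (simp_all add: algebra_character_def)
  note [lin_intros] = lin_compI[OF antipode_linear] ling_compI[OF eps(1)]
  note vs = vector_space_axioms
  note vt = vector_space_tscale
  have lift2: "tlift2 scale F (\<Delta> a) = D F a" if "lin2 F" for F a
    by (simp add: \<Delta> tlift_D[OF vs lin2_multilinear[OF that]] tensor_simps tlift_pure[OF vs lin2_multilinear[OF that]])
  have lift3: "tlift3 scale F (tri K (\<lambda>x y z. pure [x, y, z])) = tri K F" if "lin3 F" for F K
    by (simp add: tlift_tri[OF vs lin3_multilinear[OF that]] tensor_simps tlift_pure[OF vs lin3_multilinear[OF that]])
  have "sweedler_quasi_hopf scale Basis R \<epsilon> \<Phi> \<Psi> S \<alpha> \<beta>"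
  proof (intro sweedler_quasi_hopf.intro R sweedler_quasi_hopf_axioms.intro eps antipode_linear antipode_one
      antipode_mult antipode_bij counit_alpha counit_beta)
    fix F assume F: "lin2 F"
    note ev = tlift_D[OF vs lin2_multilinear[OF F]] tlift_pure[OF vs lin2_multilinear[OF F]]
    show "D F 1 = F 1 1"
      using lift2[OF F, of 1] comult_one by (simp add: tone_simps ev)
    fix a b
    have "D F (a * b) = tlift2 scale F (tmult 2 (\<Delta> a) (\<Delta> b))"
      by (simp add: lift2[OF F, symmetric] comult_mult)
    also have "\<dots> = D (\<lambda>u v. D (\<lambda>u' v'. F (u * u') (v * v')) b) a"
      by (simp add: \<Delta> ev tensor_simps)
    finally show "D F (a * b) = D (\<lambda>u v. D (\<lambda>u' v'. F (u * u') (v * v')) b) a" .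
    have ml: "multilinear tscale 3 (\<lambda>xs. tscale (\<epsilon> (xs ! 1)) (pure [xs ! 0, xs ! 2]))"
      by (rule multilinear3I[of tscale "\<lambda>x y z. tscale (\<epsilon> y) (pure [x, z])"])
        (intro linT_scale linT_scale_functional linT_pure2 eps(1))+
    have "tri \<Phi> (\<lambda>X Y Z. tscale (\<epsilon> Y) (pure [X, Z])) = pure [1, 1]"
      using assoc_counit by (simp add: \<Phi> tensor_simps tlift_tri[OF vt ml] tlift_pure[OF vt ml])
    from arg_cong[OF this, of "tlift2 scale F"]
    show "tri \<Phi> (\<lambda>X Y Z. scale (\<epsilon> Y) (F X Z)) = F 1 1"
      by (simp add: tlift_tri[OF vs lin2_multilinear[OF F]] tlift_scale[OF vs lin2_multilinear[OF F]]
          tensor_scale tensor_simps ev)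
  next
    fix F assume F: "lin3 F"
    note ev = tlift_D[OF vs lin3_multilinear[OF F]] tlift_tri[OF vs lin3_multilinear[OF F]]
      tlift_pure[OF vs lin3_multilinear[OF F]]
    show "tri \<Phi> (\<lambda>X Y Z. tri \<Psi> (\<lambda>x y z. F (X * x) (Y * y) (Z * z))) = F 1 1 1"
      using arg_cong[OF inv(2), of "tlift3 scale F"] by (simp add: \<Phi>[symmetric] \<Psi>) (simp add: \<Phi> ev tensor_simps)
    show "tri \<Psi> (\<lambda>x y z. tri \<Phi> (\<lambda>X Y Z. F (x * X) (y * Y) (z * Z))) = F 1 1 1"
      using arg_cong[OF inv(3), of "tlift3 scale F"] by (simp add: \<Phi>[symmetric] \<Psi>) (simp add: \<Phi> ev tensor_simps)
    fix a
    have m1: "multilinear tscale 2 (\<lambda>xs. D (\<lambda>u v. pure [xs ! 0, u, v]) (xs ! 1))"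
      by (rule multilinear2I[of tscale "\<lambda>x y. D (\<lambda>u v. pure [x, u, v]) y"]) (intro linT_intros)+
    have m2: "multilinear tscale 2 (\<lambda>xs. D (\<lambda>u v. pure [u, v, xs ! 1]) (xs ! 0))"
      by (rule multilinear2I[of tscale "\<lambda>x y. D (\<lambda>u v. pure [u, v, y]) x"]) (intro linT_intros)+
    show "D (\<lambda>u v. D (\<lambda>v1 v2. tri \<Phi> (\<lambda>X Y Z. F (u * X) (v1 * Y) (v2 * Z))) v) a =
       tri \<Phi> (\<lambda>X Y Z. D (\<lambda>u v. D (\<lambda>u1 u2. F (X * u1) (Y * u2) (Z * v)) u) a)"
      using arg_cong[OF quasi_coassociative[of a], of "tlift3 scale F"]
      by (simp add: \<Delta> \<Phi> ev tensor_simps tlift_D[OF vt m1] tlift_pure[OF vt m1]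
          tlift_D[OF vt m2] tlift_pure[OF vt m2])
  next
    fix F assume F: "lin4 F"
    note ev = tlift_D[OF vs lin4_multilinear[OF F]] tlift_tri[OF vs lin4_multilinear[OF F]]
      tlift_pure[OF vs lin4_multilinear[OF F]]
    have m1: "multilinear tscale 3 (\<lambda>xs. D (\<lambda>u v. pure [xs ! 0, xs ! 1, u, v]) (xs ! 2))"
      by (rule multilinear3I[of tscale "\<lambda>x y z. D (\<lambda>u v. pure [x, y, u, v]) z"]) (intro linT_intros)+
    have m2: "multilinear tscale 3 (\<lambda>xs. D (\<lambda>u v. pure [u, v, xs ! 1, xs ! 2]) (xs ! 0))"
      by (rule multilinear3I[of tscale "\<lambda>x y z. D (\<lambda>u v. pure [u, v, y, z]) x"]) (intro linT_intros)+
    have m3: "multilinear tscale 3 (\<lambda>xs. D (\<lambda>u v. pure [xs ! 0, u, v, xs ! 2]) (xs ! 1))"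
      by (rule multilinear3I[of tscale "\<lambda>x y z. D (\<lambda>u v. pure [x, u, v, z]) y"]) (intro linT_intros)+
    show "tri \<Phi> (\<lambda>X Y Z. D (\<lambda>Z1 Z2. tri \<Phi> (\<lambda>X' Y' Z'.
         D (\<lambda>X1 X2. F (X * X1) (Y * X2) (Z1 * Y') (Z2 * Z')) X')) Z) =
       tri \<Phi> (\<lambda>X Y Z. tri \<Phi> (\<lambda>X' Y' Z'. D (\<lambda>Y1 Y2. tri \<Phi> (\<lambda>X'' Y'' Z''.
         F (X' * X'') (X * Y1 * Y'') (Y * Y2 * Z'') (Z * Z'))) Y'))"
      using arg_cong[OF pentagon, of "tlift 4 scale (\<lambda>xs. F (xs ! 0) (xs ! 1) (xs ! 2) (xs ! 3))"]
      by (simp add: \<Delta> \<Phi> ev tensor_simps tlift_tri[OF vt m1] tlift_pure[OF vt m1]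
          tlift_tri[OF vt m2] tlift_pure[OF vt m2] tlift_tri[OF vt m3] tlift_pure[OF vt m3])
  next
    fix a
    have "lin2 (\<lambda>u v. scale (\<epsilon> u) v)" "lin2 (\<lambda>u v. scale (\<epsilon> v) u)" "lin2 (\<lambda>u v. S u * \<alpha> * v)"
      "lin2 (\<lambda>u v. u * \<beta> * S v)" by (intro lin_intros)+
    note l = this[THEN lift2]
    show "D (\<lambda>u v. scale (\<epsilon> u) v) a = a" "D (\<lambda>u v. scale (\<epsilon> v) u) a = a"
      "D (\<lambda>u v. S u * \<alpha> * v) a = scale (\<epsilon> a) \<alpha>" "D (\<lambda>u v. u * \<beta> * S v) a = scale (\<epsilon> a) \<beta>"
      using counit_left counit_right antipode_left antipode_right by (simp_all add: l)
  next
    have "lin3 (\<lambda>X Y Z. X * \<beta> * S Y * \<alpha> * Z)" "lin3 (\<lambda>X Y Z. S X * \<alpha> * Y * \<beta> * S Z)"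
      by (intro lin_intros)+
    note l = this[THEN lift3]
    show "tri \<Phi> (\<lambda>X Y Z. X * \<beta> * S Y * \<alpha> * Z) = 1" "tri \<Psi> (\<lambda>X Y Z. S X * \<alpha> * Y * \<beta> * S Z) = 1"
      using antipode_assoc antipode_assoc_inverse by (simp_all add: l \<Phi>[symmetric] \<Psi>) (simp_all add: \<Phi> l)
  qed
  then show ?thesis by blast
qed

end

theorem proposition5p6:
  fixes scale :: "'k::field \<Rightarrow> 'a::ring_1 \<Rightarrow> 'a"
    and \<Delta> :: "'a \<Rightarrow> ('a, 'k) tensor" and \<epsilon> :: "'a \<Rightarrow> 'k" and \<phi> :: "('a, 'k) tensor"
    and S :: "'a \<Rightarrow> 'a" and \<alpha> \<beta> :: 'a
  assumes "quasi_hopf_algebra scale \<Delta> \<epsilon> \<phi> S \<alpha> \<beta>"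
    and "unital_algebra.finite_dimensional scale"
  shows "(quasi_bialgebra.unimodular scale \<epsilon> \<longleftrightarrow>
       (\<exists>l. quasi_bialgebra.left_integral scale \<epsilon> l \<and> l \<noteq> 0 \<and> S l = l)) \<and>
    (quasi_bialgebra.unimodular scale \<epsilon> \<longleftrightarrow>
       (\<forall>l. quasi_bialgebra.left_integral scale \<epsilon> l \<and> l \<noteq> 0 \<longrightarrow> S l = l)) \<and>
    (quasi_bialgebra.unimodular scale \<epsilon> \<longleftrightarrow>
       (\<exists>l. quasi_bialgebra.right_integral scale \<epsilon> l \<and> l \<noteq> 0 \<and> S l = l)) \<and>
    (quasi_bialgebra.unimodular scale \<epsilon> \<longleftrightarrow>
       (\<forall>l. quasi_bialgebra.right_integral scale \<epsilon> l \<and> l \<noteq> 0 \<longrightarrow> S l = l)) \<and>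
    (unital_algebra.symmetric_algebra scale \<longleftrightarrow>
       quasi_bialgebra.unimodular scale \<epsilon> \<and>
       inner_automorphism (S \<circ> S))"
proof -
  interpret quasi_hopf_algebra scale \<Delta> \<epsilon> \<phi> S \<alpha> \<beta> by fact
  obtain Basis R \<Phi> \<Psi> where "sweedler_quasi_hopf scale Basis R \<epsilon> \<Phi> \<Psi> S \<alpha> \<beta>"
    using sweedler_quasi_hopf[OF assms(2)] by blast
  then interpret K: sweedler_quasi_hopf scale Basis R \<epsilon> \<Phi> \<Psi> S \<alpha> \<beta> .
  have integrals: "left_integral = K.left_int" "right_integral = K.right_int"
    by (simp_all add: fun_eq_iff left_integral_def right_integral_def K.left_int_def K.right_int_def)
  have unimodular: "unimodular \<longleftrightarrow> (\<forall>l. K.left_int l \<longrightarrow> K.right_int l)"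
    unfolding unimodular_def modulus_def integrals by (rule K.modulus_eq_eps_iff)
  show ?thesis
    unfolding unimodular integrals
    by (intro conjI K.two_sided_iff_S_invariant K.symmetric_iff)
qed

end
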